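(* Let $\Lambda>0$ and $\gamma>-5$ be real. For all multi-indices $\alpha,\lambda,\kappa\in\mathbb{N}^3$, the coefficient $A_{\alpha}^{\lambda,\kappa}$ of the quadratic Fokker–Planck–Landau collision operator in the Hermite basis, defined by $$A_{\alpha}^{\lambda,\kappa} = \frac{1}{\alpha!}\int_{\mathbb{R}^3} H^{\alpha}(v)\,\nabla_{v}\cdot\int_{\mathbb{R}^3} A(v-v_* )\Big(H^{\lambda}(v_* )\mathcal{M}(v_* )\nabla_{v}\big(H^{\kappa}(v)\mathcal{M}(v)\big)-H^{\lambda}(v)\mathcal{M}(v)\nabla_{v_*}\big(H^{\kappa}(v_* )\mathcal{M}(v_* )\big)\Big)\,\mathrm{d}v_*\,\mathrm{d}v,$$ satisfies $$A_{\alpha}^{\lambda,\kappa} = 2^{(\gamma+3-|\alpha|)/2}\sum_{s,t=1}^3\ \sum_{|p|=0}^{|\alpha|-1}\frac{\Lambda}{q^{[s]}!}\Big(a_{p,r^{[t]}}^{\kappa+e_t,\lambda}-a_{p,r^{[t]}}^{\lambda,\kappa+e_t}\Big)B_{r^{[t]}}^{q^{[s]}}(\gamma,s,t),$$ where $p=(p_1,p_2,p_3)\in\mathbb{N}^3$ is a three-dimensional multi-index, $$q^{[s]}=\alpha-e_s-p,\qquad r^{[t]}=\lambda+\kappa+e_t-p,$$ and, for given $s,t$, only those $p$ are included in the sum for which all entries of $q^{[s]}$ and $r^{[t]}$ are non-negative. Here, for multi-indices, $$a_{p,q}^{\lambda,\kappa}=\prod_{i=1}^3 a_{p_iq_i}^{\lambda_i\kappa_i},$$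 where for non-negative integers $p,q,\lambda,\kappa$ (with $p+q=\lambda+\kappa$) $$a_{pq}^{\lambda\kappa}=2^{-(p+q)/2}\lambda!\,\kappa!\sum_{s=\max(0,p-\kappa)}^{\min(p,\lambda)}\frac{(-1)^{q-\lambda+s}}{s!(\lambda-s)!(p-s)!(q-\lambda+s)!},$$ and, for multi-indices $p,q\in\mathbb{N}^3$ and $s,t\in\{1,2,3\}$, $$B_{p}^{q}(\gamma,s,t)=-G_{st}(\gamma,p,q)+\delta_{st}\sum_{r=1}^3G_{rr}(\gamma,p,q),\qquad G_{st}(\gamma,p,q)=\int_{\mathbb{R}^3}|g|^{\gamma}g_sg_tH^{p}(g)H^{q}(g)\mathcal{M}(g)\,\mathrm{d}g.$$
   Context: $\mathbb{N}=\{0,1,2,\dots\}$. For a multi-index $\alpha=(\alpha_1,\alpha_2,\alpha_3)\in\mathbb{N}^3$: $|\alpha|=\alpha_1+\alpha_2+\alpha_3$, $\alpha!=\alpha_1!\alpha_2!\alpha_3!$; $e_i$ is the multi-index whose $i$-th entry is $1$ and whose other entries are $0$; $\delta_{st}$ is the Kronecker delta. An empty sum is $0$. Maxwellian: $\mathcal{M}(v)=(2\pi)^{-3/2}\exp(-|v|^2/2)$ for $v\in\mathbb{R}^3$. Hermite polynomials: for $\alpha\in\mathbb{N}^3$, $$H^{\alpha}(v)=\frac{(-1)^{|\alpha|}}{\mathcal{M}(v)}\frac{\partial^{|\alpha|}}{\partial v_1^{\alpha_1}\partial v_2^{\alpha_2}\partial v_3^{\alpha_3}}\mathcal{M}(v);$$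 they satisfy $\int_{\mathbb{R}^3}H^\alpha H^\beta\mathcal{M}\,\mathrm{d}v=\delta_{\alpha,\beta}\,\alpha!$. Collision kernel: for $v\in\mathbb{R}^3\setminus\{0\}$, $A(v)$ is the symmetric $3\times3$ matrix $A(v)=\Lambda|v|^{\gamma+2}\Pi(v)$ with $\Pi_{ij}(v)=\delta_{ij}-\frac{v_iv_j}{|v|^2}$. The coefficients arise from the collision operator $\mathcal{Q}[f](v)=\nabla_v\cdot\int_{\mathbb{R}^3}A(v-v_* )\big(f(v_* )\nabla_vf(v)-f(v)\nabla_{v_*}f(v_* )\big)\,\mathrm{d}v_*$: if $f=\sum_\alpha f_\alpha H^\alpha\mathcal{M}$ and $\mathcal{Q}[f]=\sum_\alpha Q_\alpha H^\alpha\mathcal{M}$, then $Q_\alpha=\sum_{\lambda,\kappa}A_\alpha^{\lambda,\kappa}f_\lambda f_\kappa$. *)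

theory Defs
  imports "HOL-Analysis.Analysis"
begin

type_synonym R3 = "real ^ 3"
type_synonym multi_index = "nat ^ 3"

definition mi_abs :: "multi_index \<Rightarrow> nat" where
  "mi_abs \<alpha> = (\<Sum>i\<in>UNIV. \<alpha> $ i)"

definition mi_fact :: "multi_index \<Rightarrow> real" where
  "mi_fact \<alpha> = (\<Prod>i\<in>UNIV. fact (\<alpha> $ i))"

abbreviation unit_index :: "3 \<Rightarrow> multi_index" where
  "unit_index i \<equiv> axis i 1"

definition partial_deriv :: "3 \<Rightarrow> (R3 \<Rightarrow> real) \<Rightarrow> R3 \<Rightarrow> real" where
  "partial_deriv i f v = deriv (\<lambda>h. f (v + h *\<^sub>R axis i 1)) 0"

definition mixed_partial :: "multi_index \<Rightarrow> (R3 \<Rightarrow> real) \<Rightarrow> R3 \<Rightarrow> real" where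
  "mixed_partial \<alpha> f =
    (partial_deriv 1 ^^ (\<alpha> $ 1)) ((partial_deriv 2 ^^ (\<alpha> $ 2)) ((partial_deriv 3 ^^ (\<alpha> $ 3)) f))"

definition grad :: "(R3 \<Rightarrow> real) \<Rightarrow> R3 \<Rightarrow> R3" where
  "grad f v = (\<chi> i. partial_deriv i f v)"

definition divergence :: "(R3 \<Rightarrow> R3) \<Rightarrow> R3 \<Rightarrow> real" where
  "divergence F v = (\<Sum>i\<in>UNIV. partial_deriv i (\<lambda>u. F u $ i) v)"

definition maxwellian :: "R3 \<Rightarrow> real" where
  "maxwellian v = (2 * pi) powr (- 3 / 2) * exp (- (norm v)\<^sup>2 / 2)"

definition hermite :: "multi_index \<Rightarrow> R3 \<Rightarrow> real" where
  "hermite \<alpha> v = (- 1) ^ mi_abs \<alpha> / maxwellian v * mixed_partial \<alpha> maxwellian v"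

definition proj_matrix :: "R3 \<Rightarrow> real ^ 3 ^ 3" where
  "proj_matrix v = (\<chi> i j. (if i = j then 1 else 0) - v $ i * v $ j / (norm v)\<^sup>2)"

text \<open>
  The kernel is only meaningful for \<open>v \<noteq> 0\<close>.  At the origin this definition yields the zero
  matrix, because \<open>0 powr a = 0\<close>; a single point does not affect the integrals below.
\<close>

definition landau_kernel :: "real \<Rightarrow> real \<Rightarrow> R3 \<Rightarrow> real ^ 3 ^ 3" where
  "landau_kernel \<Lambda> \<gamma> v = (\<Lambda> * norm v powr (\<gamma> + 2)) *\<^sub>R proj_matrix v"

text \<open>
  The bilinear form of the collision operator: \<open>\<Q>[f]\<close> is its value at \<open>(f, f)\<close>.
\<close>

definition landau_bilinear ::
    "real \<Rightarrow> real \<Rightarrow> (R3 \<Rightarrow> real) \<Rightarrow> (R3 \<Rightarrow> real) \<Rightarrow> R3 \<Rightarrow> real" where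
  "landau_bilinear \<Lambda> \<gamma> f g =
    divergence (\<lambda>v. \<integral>w. landau_kernel \<Lambda> \<gamma> (v - w) *v (f w *\<^sub>R grad g v - f v *\<^sub>R grad g w) \<partial>lborel)"

definition landau_coeff ::
    "real \<Rightarrow> real \<Rightarrow> multi_index \<Rightarrow> multi_index \<Rightarrow> multi_index \<Rightarrow> real" where
  "landau_coeff \<Lambda> \<gamma> \<alpha> lam \<kappa> =
    1 / mi_fact \<alpha> *
      (\<integral>v. hermite \<alpha> v *
        landau_bilinear \<Lambda> \<gamma> (\<lambda>u. hermite lam u * maxwellian u)
          (\<lambda>u. hermite \<kappa> u * maxwellian u) v \<partial>lborel)"

text \<open>
  The coefficient \<open>a\<close> is used only when \<open>p + q = l + k\<close>.  Under this condition the truncated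
  subtractions below are faithful: the natural number \<open>p - k\<close> is the maximum of \<open>0\<close> and the integer
  difference, and \<open>q + s - l\<close> is an exact difference for every \<open>s\<close> in the range of summation.
\<close>

definition a1 :: "nat \<Rightarrow> nat \<Rightarrow> nat \<Rightarrow> nat \<Rightarrow> real" where
  "a1 l k p q =
    2 powr (- real (p + q) / 2) * fact l * fact k *
      (\<Sum>s = p - k..min p l.
        (- 1) ^ (q + s - l) / (fact s * fact (l - s) * fact (p - s) * fact (q + s - l)))"

definition a3 :: "multi_index \<Rightarrow> multi_index \<Rightarrow> multi_index \<Rightarrow> multi_index \<Rightarrow> real" where
  "a3 lam \<kappa> p q = (\<Prod>i\<in>UNIV. a1 (lam $ i) (\<kappa> $ i) (p $ i) (q $ i))"

definition G_int :: "real \<Rightarrow> 3 \<Rightarrow> 3 \<Rightarrow> multi_index \<Rightarrow> multi_index \<Rightarrow> real" where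
  "G_int \<gamma> s t p q =
    (\<integral>g. norm g powr \<gamma> * g $ s * g $ t * hermite p g * hermite q g * maxwellian g \<partial>lborel)"

text \<open>The lower index \<open>p\<close> of \<open>B\<close> comes first, followed by the upper index \<open>q\<close>.\<close>

definition B_coeff :: "real \<Rightarrow> 3 \<Rightarrow> 3 \<Rightarrow> multi_index \<Rightarrow> multi_index \<Rightarrow> real" where
  "B_coeff \<gamma> s t p q =
    - G_int \<gamma> s t p q + (if s = t then 1 else 0) * (\<Sum>r\<in>UNIV. G_int \<gamma> r r p q)"

text \<open>
  The multi-indices \<open>p\<close> admitted for given \<open>s\<close>, \<open>t\<close>: the two order conditions say that
  \<open>\<alpha> - e\<^sub>s - p\<close> and \<open>lam + \<kappa> + e\<^sub>t - p\<close> have non-negative entries, so that these differences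
  are exact although subtraction on natural numbers is truncated.
\<close>

definition admissible ::
    "multi_index \<Rightarrow> multi_index \<Rightarrow> multi_index \<Rightarrow> 3 \<Rightarrow> 3 \<Rightarrow> multi_index set" where
  "admissible \<alpha> lam \<kappa> s t =
    {p. mi_abs p < mi_abs \<alpha> \<and> p + unit_index s \<le> \<alpha> \<and> p \<le> lam + \<kappa> + unit_index t}"

end

theory Submission
  imports Defs "HOL-Probability.Distributions" "HOL-Computational_Algebra.Polynomial"
begin

text \<open>
  Write \<open>\<Psi>\<^sub>b = H\<^sup>b \<M>\<close> for the Hermite functions (\<open>hermite_fun3\<close> below). They satisfy
  \<open>\<partial>\<^sub>t \<Psi>\<^sub>b = - \<Psi>\<^bsub>b + e\<^sub>t\<^esub>\<close>, so the flux inside the divergence is a sum of products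
  \<open>\<Psi>\<^sub>a (A\<^sub>s\<^sub>t * \<Psi>\<^sub>b)\<close> of a Hermite function and a convolution. The kernel \<open>A\<^sub>s\<^sub>t\<close> has growth
  \<open>\<bar>u\<bar> powr (\<gamma> + 2)\<close> with \<open>\<gamma> + 2 > - 3\<close>: it is locally integrable on the three-dimensional space, and
  the derivative of the convolution can be put on the Gaussian factor alone
  (\<open>conv_has_derivative\<close>).

  By Fubini every term of the coefficient becomes an integral of \<open>A\<^sub>s\<^sub>t(u)\<close> against
  \<open>J(u) = \<integral> H\<^sup>a(v) \<Psi>\<^sub>b(v) \<Psi>\<^sub>c(v - u) dv\<close>, which is a product of three one-dimensional integrals of smooth,
  rapidly decaying functions. Integration by parts takes place in \<open>J\<close> for fixed \<open>u\<close>, where the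
  singular kernel does not occur, and moves the divergence to \<open>H\<^sup>\<alpha>\<close>. Since
  \<open>\<partial>\<^sub>s H\<^sup>\<alpha> = \<alpha>\<^sub>s H\<^bsub>\<alpha> - e\<^sub>s\<^esub>\<close>, this leaves integrals with \<open>a = \<alpha> - e\<^sub>s\<close> and with
  \<open>{b, c} = {\<kappa> + e\<^sub>t, \<lambda>}\<close> (\<open>landau_coeff_eq_kern_moment\<close>).

  It remains to compute \<open>J\<close>. In the rotated velocities \<open>v = (h + g) / \<surd>2\<close>, \<open>v - u = (h - g) / \<surd>2\<close>, that is
  \<open>u = \<surd>2 g\<close>, the product of the two Maxwellians keeps its form. A product of two Hermite polynomials in
  the old variables is a combination of products in the new ones, whose coefficients are the numbers
  \<open>a1\<close> (\<open>he_rotate\<close>), and orthogonality in \<open>h\<close> reduces the two resulting sums to one sum over \<open>p\<close>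
  (\<open>triple_integral_rotate\<close>). What is left of the integral over \<open>g\<close> is \<open>B_coeff\<close> (\<open>kern_moment_eq_sum\<close>).
\<close>

section \<open>The coefficients of a rotation by 45 degrees\<close>

text \<open>
  Powers are divided by the factorial so that the derivative lowers the exponent without a factor;
  the recurrences for \<open>a1\<close> then carry no binomial weights.
\<close>

definition div_power :: "real \<Rightarrow> nat \<Rightarrow> real poly" where
  "div_power c p = smult (1 / fact p) ([:c, 1:] ^ p)"

lemma pderiv_div_power: "pderiv (div_power c p) = (if p = 0 then 0 else div_power c (p - 1))"
proof (cases p)
  case (Suc n)
  have "real (Suc n) / fact (Suc n) = 1 / fact n" by (simp only: fact_Suc of_nat_mult) simp
  then show ?thesis using Suc
    by (simp add: div_power_def pderiv_smult pderiv_power_Suc pderiv_pCons del: power_Suc fact_Suc of_nat_Suc)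
qed (simp add: div_power_def)

lemma linear_times_div_power:
  "p \<noteq> 0 \<Longrightarrow> [:c, 1:] * div_power c (p - 1) = smult (real p) (div_power c p)"
  by (cases p) (simp_all add: div_power_def del: mult_pCons_left)

text \<open>
  The form \<open>(x + y)\<^sup>p (x - y)\<^sup>q / (p! q!)\<close> at \<open>y = 1\<close>: it is the coefficient of \<open>H\<^sub>p(h) H\<^sub>q(g)\<close> when the
  generating function \<open>\<Sum> H\<^sub>l(X) H\<^sub>k(Y) x\<^sup>l y\<^sup>k / (l! k!)\<close> of products of Hermite polynomials is expanded at
  \<open>X = (h + g) / \<surd>2\<close>, \<open>Y = (h - g) / \<surd>2\<close>, up to the factor \<open>2 powr (- (p + q) / 2)\<close>.
\<close>

definition rot_poly :: "nat \<Rightarrow> nat \<Rightarrow> real poly" where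
  "rot_poly p q = div_power 1 p * div_power (- 1) q"

lemma coeff_linear_plus: "coeff ([:1, 1:] ^ p) i = (real (p choose i))"
  using coeff_linear_poly_power[of i p 1 "1::real"]
  by (cases "i \<le> p") (simp_all add: coeff_linear_poly_power coeff_eq_0 degree_linear_power binomial_eq_0)

lemma coeff_linear_minus:
  "coeff ([:-1, 1:] ^ q) i = (if i \<le> q then real (q choose i) * (-1) ^ (q - i) else (0::real))"
  by (cases "i \<le> q") (simp_all add: coeff_linear_poly_power coeff_eq_0 degree_linear_power)

text \<open>
  The binomial theorem for both powers gives the sum that defines \<open>a1\<close>; outside its range of
  summation one of the two binomial coefficients is zero.
\<close>

lemma a1_eq_coeff:
  assumes "p + q = l + k"
  shows "a1 l k p q = 2 powr (- real (p + q) / 2) * fact l * fact k * coeff (rot_poly p q) l"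
proof -
  have "coeff ([:1, 1:] ^ p * [:-1, 1:] ^ q) l =
      (\<Sum>s\<le>l. real (p choose s) * (if l - s \<le> q then real (q choose (l - s)) * (-1) ^ (q - (l - s)) else 0))"
    by (simp only: coeff_mult coeff_linear_plus coeff_linear_minus)
  also have "\<dots> = (\<Sum>s = p - k..min p l. real (p choose s) * (real (q choose (l - s)) * (-1) ^ (q + s - l)))"
  proof (rule sum.mono_neutral_cong_right)
    show "\<forall>s\<in>{..l} - {p - k..min p l}. real (p choose s) * (if l - s \<le> q then real (q choose (l - s)) * (-1) ^ (q - (l - s)) else 0) = 0"
      using assms by (auto simp: binomial_eq_0)
  qed (use assms in auto)
  also have "\<dots> = fact p * fact q * (\<Sum>s = p - k..min p l.
        (- 1) ^ (q + s - l) / (fact s * fact (l - s) * fact (p - s) * fact (q + s - l)))"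
    unfolding sum_distrib_left
  proof (rule sum.cong)
    fix s assume s: "s \<in> {p - k..min p l}"
    have e: "q - (l - s) = q + s - l" using s assms by auto
    show "real (p choose s) * (real (q choose (l - s)) * (-1) ^ (q + s - l)) =
       fact p * fact q * ((- 1) ^ (q + s - l) / (fact s * fact (l - s) * fact (p - s) * fact (q + s - l)))"
    proof -
      have "l - s \<le> q" using s assms by auto
      then have "real (q choose (l - s)) = fact q / (fact (l - s) * fact (q + s - l))"
        using e by (simp add: binomial_fact)
      moreover have "real (p choose s) = fact p / (fact s * fact (p - s))"
        using s by (simp add: binomial_fact)
      ultimately show ?thesis by (simp add: mult_ac)
    qed
  qed simp
  finally show ?thesis by (simp add: a1_def rot_poly_def div_power_def)
qed

text \<open>
  The derivative of the form in its first variable, by the product rule.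
\<close>

lemma coeff_rot_poly_Suc:
  "real (Suc l) * coeff (rot_poly p q) (Suc l) =
     (if p = 0 then 0 else coeff (rot_poly (p - 1) q) l) +
     (if q = 0 then 0 else coeff (rot_poly p (q - 1)) l)"
proof -
  have d: "pderiv (rot_poly p q) = (if p = 0 then 0 else rot_poly (p - 1) q) +
     (if q = 0 then 0 else rot_poly p (q - 1))"
    by (simp add: rot_poly_def pderiv_mult pderiv_div_power mult.commute)
  show ?thesis
    by (subst coeff_pderiv[symmetric], subst d) simp
qed

text \<open>
  The derivative of the form \<open>R\<close> in its second variable. At \<open>y = 1\<close> only the first variable is left, and
  Euler's identity for a form of degree \<open>p + q\<close> expresses that derivative as \<open>(p + q) R - x R'\<close>.
\<close>

lemma coeff_rot_poly_complement:
  assumes "p + q = l + k + 1"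
  shows "real (Suc k) * coeff (rot_poly p q) l =
     (if p = 0 then 0 else coeff (rot_poly (p - 1) q) l) -
     (if q = 0 then 0 else coeff (rot_poly p (q - 1)) l)"
proof -
  have x: "smult (real p) (div_power c p) - [:0, 1:] * pderiv (div_power c p) =
      (if p = 0 then 0 else smult c (div_power c (p - 1)))" for c p
  proof (cases "p = 0")
    case False
    have "smult (real p) (div_power c p) = smult c (div_power c (p - 1)) + [:0, 1:] * div_power c (p - 1)"
      using linear_times_div_power[OF False, of c] by simp
    then show ?thesis using False by (simp add: pderiv_div_power)
  qed (simp add: pderiv_div_power)
  have "smult (real (p + q)) (rot_poly p q) - [:0,1:] * pderiv (rot_poly p q) =
     (smult (real p) (div_power 1 p) - [:0, 1:] * pderiv (div_power 1 p)) * div_power (- 1) q +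
     div_power 1 p * (smult (real q) (div_power (- 1) q) - [:0, 1:] * pderiv (div_power (- 1) q))"
    unfolding rot_poly_def pderiv_mult of_nat_add by (simp add: algebra_simps smult_add_left)
  then have d: "smult (real (p + q)) (rot_poly p q) - [:0,1:] * pderiv (rot_poly p q) = (if p = 0 then 0 else rot_poly (p - 1) q) -
     (if q = 0 then 0 else rot_poly p (q - 1))"
    unfolding x by (simp add: rot_poly_def)
  have "coeff (smult (real (p + q)) (rot_poly p q) - [:0,1:] * pderiv (rot_poly p q)) l = real (Suc k) * coeff (rot_poly p q) l"
  proof (cases l)
    case (Suc m)
    have "real (p + q) = real (Suc m) + real (Suc k)" using assms Suc by simp
    then show ?thesis using Suc by (simp add: coeff_pderiv algebra_simps del: of_nat_add)
  qed (use assms in \<open>simp add: algebra_simps flip: of_nat_add\<close>)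
  then show ?thesis unfolding d by (auto split: if_splits)
qed

lemma a1_0_0 [simp]: "a1 0 0 0 0 = 1"
  by (simp add: a1_def)

lemma two_powr_half_Suc: "2 powr (- real (Suc n) / 2) = 2 powr (- real n / 2) / sqrt 2"
proof -
  have "2 powr (- real (Suc n) / 2) = 2 powr (- real n / 2 - 1/2)" by (rule arg_cong) (simp add: field_simps)
  also have "\<dots> = 2 powr (- real n / 2) / sqrt 2" by (simp add: powr_diff powr_half_sqrt)
  finally show ?thesis .
qed

text \<open>
  In the rotated variables the derivatives along \<open>X\<close> and \<open>Y\<close> are the sum and the difference of the
  derivatives along \<open>h\<close> and \<open>g\<close>, divided by \<open>\<surd>2\<close>. The next two recurrences are the counterparts for the
  coefficients.
\<close>

lemma a1_Suc_left:
  assumes "p + q = Suc (l + k)"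
  shows "sqrt 2 * a1 (Suc l) k p q =
    (if p = 0 then 0 else a1 l k (p - 1) q) + (if q = 0 then 0 else a1 l k p (q - 1))"
proof -
  define c where "c = 2 powr (- real (l + k) / 2) * fact l * (fact k :: real)"
  have "a1 (Suc l) k p q = 2 powr (- real (Suc (l + k)) / 2) * fact (Suc l) * fact k * coeff (rot_poly p q) (Suc l)"
    using assms a1_eq_coeff[of p q "Suc l" "k"] by simp
  then have "sqrt 2 * a1 (Suc l) k p q = c * (real (Suc l) * coeff (rot_poly p q) (Suc l))"
    unfolding two_powr_half_Suc c_def by (simp only: fact_Suc of_nat_mult) simp
  also have "real (Suc l) * coeff (rot_poly p q) (Suc l) =
     (if p = 0 then 0 else coeff (rot_poly (p - 1) q) l) +
     (if q = 0 then 0 else coeff (rot_poly p (q - 1)) l)"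
    using coeff_rot_poly_Suc[of l p q] assms by simp
  also have "c * \<dots> = (if p = 0 then 0 else c * coeff (rot_poly (p - 1) q) l) +
     (if q = 0 then 0 else c * coeff (rot_poly p (q - 1)) l)"
    by (simp add: algebra_simps)
  also have "(if p = 0 then 0 else c * coeff (rot_poly (p - 1) q) l) = (if p = 0 then 0 else a1 l k (p - 1) q)"
    using assms a1_eq_coeff[of "p - 1" q l k] by (auto simp: c_def)
  also have "(if q = 0 then 0 else c * coeff (rot_poly p (q - 1)) l) = (if q = 0 then 0 else a1 l k p (q - 1))"
    using assms a1_eq_coeff[of p "q - 1" l k] by (auto simp: c_def)
  finally show ?thesis .
qed

lemma a1_Suc_right:
  assumes "p + q = Suc (l + k)"
  shows "sqrt 2 * a1 l (Suc k) p q =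
    (if p = 0 then 0 else a1 l k (p - 1) q) - (if q = 0 then 0 else a1 l k p (q - 1))"
proof -
  define c where "c = 2 powr (- real (l + k) / 2) * fact l * (fact k :: real)"
  have "a1 l (Suc k) p q = 2 powr (- real (Suc (l + k)) / 2) * fact l * fact (Suc k) * coeff (rot_poly p q) l"
    using assms a1_eq_coeff[of p q "l" "Suc k"] by simp
  then have "sqrt 2 * a1 l (Suc k) p q = c * (real (Suc k) * coeff (rot_poly p q) l)"
    unfolding two_powr_half_Suc c_def by (simp only: fact_Suc of_nat_mult) simp
  also have "real (Suc k) * coeff (rot_poly p q) l =
     (if p = 0 then 0 else coeff (rot_poly (p - 1) q) l) -
     (if q = 0 then 0 else coeff (rot_poly p (q - 1)) l)"
    using coeff_rot_poly_complement[of p q l k] assms by simp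
  also have "c * \<dots> = (if p = 0 then 0 else c * coeff (rot_poly (p - 1) q) l) -
     (if q = 0 then 0 else c * coeff (rot_poly p (q - 1)) l)"
    by (simp add: algebra_simps)
  also have "(if p = 0 then 0 else c * coeff (rot_poly (p - 1) q) l) = (if p = 0 then 0 else a1 l k (p - 1) q)"
    using assms a1_eq_coeff[of "p - 1" q l k] by (auto simp: c_def)
  also have "(if q = 0 then 0 else c * coeff (rot_poly p (q - 1)) l) = (if q = 0 then 0 else a1 l k p (q - 1))"
    using assms a1_eq_coeff[of p "q - 1" l k] by (auto simp: c_def)
  finally show ?thesis .
qed

lemma a1_zero_right:
  assumes "p \<le> l"
  shows "a1 l 0 p (l - p) = 2 powr (- real l / 2) * real (l choose p)"
  using assms by (simp add: a1_def binomial_fact)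

section \<open>Hermite functions of one variable\<close>

text \<open>
  The probabilists' polynomials. The recursion is read off from
  \<open>(- d/dx) (he n \<cdot> gauss) = he (n + 1) \<cdot> gauss\<close>, so that the Rodrigues formula for \<open>hermite\<close> becomes a
  statement about repeated derivatives.
\<close>

fun he :: "nat \<Rightarrow> real poly" where
  "he 0 = 1"
| "he (Suc n) = [:0, 1:] * he n - pderiv (he n)"

lemma pderiv_he_Suc: "pderiv (he (Suc n)) = smult (real (Suc n)) (he n)"
proof (induction n rule: less_induct)
  case (less n)
  show ?case
  proof (cases n)
    case 0 then show ?thesis by (simp add: pderiv_pCons)
  next
    case (Suc m)
    have IH: "pderiv (he n) = smult (real n) (he m)" using less[of m] Suc by simp
    have "pderiv (he (Suc n)) = he n + [:0,1:] * pderiv (he n) - pderiv (pderiv (he n))"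
      by (simp add: pderiv_diff pderiv_mult pderiv_pCons)
    also have "\<dots> = he n + smult (real n) ([:0,1:] * he m - pderiv (he m))"
      unfolding IH by (simp add: pderiv_smult smult_diff_right)
    also have "[:0,1:] * he m - pderiv (he m) = he n" using Suc by simp
    finally show ?thesis by (simp add: smult_add_left)
  qed
qed

lemma pderiv_he: "pderiv (he n) = smult (real n) (he (n - 1))"
  by (cases n) (simp_all del: he.simps(2) add: pderiv_he_Suc he.simps(1))

abbreviation gauss :: "real \<Rightarrow> real" where "gauss \<equiv> std_normal_density"

definition hermite_fun :: "nat \<Rightarrow> real \<Rightarrow> real" where
  "hermite_fun n x = poly (he n) x * gauss x"

lemma gauss_has_derivative:
  "(gauss has_real_derivative - x * gauss x) (at x)"
  unfolding std_normal_density_def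
  by (auto intro!: derivative_eq_intros simp: field_simps power2_eq_square)

lemma poly_gauss_has_derivative:
  "((\<lambda>x. poly p x * gauss x) has_real_derivative poly (pderiv p - [:0,1:] * p) x * gauss x) (at x)"
  by (auto intro!: derivative_eq_intros poly_DERIV gauss_has_derivative simp: algebra_simps)

lemma hermite_fun_has_derivative [derivative_intros]:
  assumes "(f has_real_derivative f') (at x within A)"
  shows "((\<lambda>x. hermite_fun n (f x)) has_real_derivative - hermite_fun (Suc n) (f x) * f') (at x within A)"
proof -
  have "(hermite_fun n has_real_derivative - hermite_fun (Suc n) y) (at y)" for y
    unfolding hermite_fun_def[abs_def] by (rule DERIV_cong[OF poly_gauss_has_derivative]) (simp add: algebra_simps)
  from DERIV_chain2[OF this assms] show ?thesis .
qed

lemma continuous_on_hermite_fun [continuous_intros]: "continuous_on A f \<Longrightarrow> continuous_on A (\<lambda>x. hermite_fun n (f x))"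
  unfolding hermite_fun_def std_normal_density_def by (intro continuous_intros) auto

lemma borel_measurable_hermite_fun [measurable]: "hermite_fun n \<in> borel_measurable borel"
  by (intro borel_measurable_continuous_onI continuous_intros)

lemma borel_measurable_poly [measurable]: "poly (p::real poly) \<in> borel_measurable borel"
  by (intro borel_measurable_continuous_onI continuous_intros)

lemma gauss_pos: "gauss x > 0" by (simp add: normal_density_pos)

lemma gauss_rotate: "gauss ((h + g) / sqrt 2) * gauss ((h - g) / sqrt 2) = gauss h * gauss g"
proof -
  have "((h + g) / sqrt 2)\<^sup>2 + ((h - g) / sqrt 2)\<^sup>2 = h\<^sup>2 + g\<^sup>2"
    by (simp add: power_divide) (simp add: power2_eq_square field_simps)
  then have "exp (- ((h + g) / sqrt 2)\<^sup>2 / 2) * exp (- ((h - g) / sqrt 2)\<^sup>2 / 2) = exp (- h\<^sup>2 / 2) * exp (- g\<^sup>2 / 2)"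
    unfolding exp_add[symmetric] by (intro arg_cong[where f=exp]) argo
  then show ?thesis unfolding std_normal_density_def by (simp add: algebra_simps)
qed

text \<open>
  A derivative along the direction \<open>(1, e) / \<surd>2\<close> raises one of the two orders in each term of an
  expansion of degree \<open>n\<close>; collecting equal terms shifts the coefficients.
\<close>

lemma hermite_fun_expansion_derivative:
  assumes E: "\<And>h g. F h g = (\<Sum>p\<le>n. c p * hermite_fun p h * hermite_fun (n - p) g)"
    and D: "((\<lambda>t. F (h + t / sqrt 2) (g + e * t / sqrt 2)) has_real_derivative - F') (at 0)"
  shows "F' = (\<Sum>p\<le>Suc n. ((if p = 0 then 0 else c (p - 1)) + e * (if p = Suc n then 0 else c p)) / sqrt 2
    * hermite_fun p h * hermite_fun (Suc n - p) g)"
proof -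
  have s2: "sqrt 2 * (sqrt 2 * x) = 2 * x" for x :: real
    by (simp flip: mult.assoc)
  have "((\<lambda>t. F (h + t / sqrt 2) (g + e * t / sqrt 2)) has_real_derivative
     - (\<Sum>p\<le>n. c p * (hermite_fun (Suc p) h * hermite_fun (n - p) g + e * hermite_fun p h * hermite_fun (Suc n - p) g) / sqrt 2)) (at 0)"
    unfolding E
    by (auto intro!: derivative_eq_intros sum.cong
          simp: sum_negf[symmetric] algebra_simps Suc_diff_le add_divide_distrib)
      (simp add: field_simps s2)
  from DERIV_unique[OF D this]
  have "F' = (\<Sum>p\<le>n. c p * (hermite_fun (Suc p) h * hermite_fun (n - p) g + e * hermite_fun p h * hermite_fun (Suc n - p) g) / sqrt 2)"
    by simp
  moreover have "(\<Sum>p\<le>Suc n. (if p = 0 then 0 else c (p - 1)) / sqrt 2 * hermite_fun p h * hermite_fun (Suc n - p) g)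
       = (\<Sum>p\<le>n. c p * (hermite_fun (Suc p) h * hermite_fun (n - p) g) / sqrt 2)"
    by (subst sum.atMost_Suc_shift) (simp add: mult_ac)
  moreover have "(\<Sum>p\<le>Suc n. e * (if p = Suc n then 0 else c p) / sqrt 2 * hermite_fun p h * hermite_fun (Suc n - p) g)
       = (\<Sum>p\<le>n. c p * (e * hermite_fun p h * hermite_fun (Suc n - p) g) / sqrt 2)"
    by (subst sum.atMost_Suc) (auto intro!: sum.cong)
  ultimately show ?thesis
    by (simp add: sum.distrib add_divide_distrib distrib_left distrib_right del: sum.atMost_Suc)
qed

lemma rotate_plus:
  "(h + t / sqrt 2 + (g + t / sqrt 2)) / sqrt 2 = (h + g) / sqrt 2 + t"
  "(h + t / sqrt 2 - (g + t / sqrt 2)) / sqrt 2 = (h - g) / sqrt 2"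
  by (simp_all add: add_divide_distrib diff_divide_distrib)

lemma rotate_minus:
  "(h + t / sqrt 2 + (g + - 1 * t / sqrt 2)) / sqrt 2 = (h + g) / sqrt 2"
  "(h + t / sqrt 2 - (g + - 1 * t / sqrt 2)) / sqrt 2 = (h - g) / sqrt 2 + t"
  by (simp_all add: add_divide_distrib diff_divide_distrib)

text \<open>
  Rotation invariance of the Gaussian weight is the case of orders zero. Each further order is produced
  by differentiating along the direction in which only one of \<open>X\<close> and \<open>Y\<close> varies.
\<close>

lemma hermite_fun_rotate:
  "hermite_fun k ((h + g) / sqrt 2) * hermite_fun l ((h - g) / sqrt 2) =
   (\<Sum>p\<le>k + l. a1 k l p (k + l - p) * hermite_fun p h * hermite_fun (k + l - p) g)"
proof (induction k arbitrary: h g)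
  case 0
  show ?case
  proof (induction l arbitrary: h g)
    case 0
    show ?case using gauss_rotate[of h g] by (simp add: hermite_fun_def)
  next
    case (Suc l)
    have D: "((\<lambda>t. hermite_fun 0 ((h + t / sqrt 2 + (g + - 1 * t / sqrt 2)) / sqrt 2) *
          hermite_fun l ((h + t / sqrt 2 - (g + - 1 * t / sqrt 2)) / sqrt 2)) has_real_derivative
        - (hermite_fun 0 ((h + g) / sqrt 2) * hermite_fun (Suc l) ((h - g) / sqrt 2))) (at 0)"
      unfolding rotate_minus by (auto intro!: derivative_eq_intros)
    show ?case
      unfolding hermite_fun_expansion_derivative[where F="\<lambda>h g. hermite_fun 0 ((h + g) / sqrt 2) * hermite_fun l ((h - g) / sqrt 2)", OF Suc.IH D] add_0
    proof (rule sum.cong)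
      fix p assume "p \<in> {..Suc l}"
      then have "((if p = 0 then 0 else a1 0 l (p - 1) (l - (p - 1))) + - 1 * (if p = Suc l then 0 else a1 0 l p (l - p)))
          = sqrt 2 * a1 0 (Suc l) p (Suc l - p)"
        using a1_Suc_right[of p "Suc l - p" 0 l] by auto
      then show "((if p = 0 then 0 else a1 0 l (p - 1) (l - (p - 1))) + - 1 * (if p = Suc l then 0 else a1 0 l p (l - p))) / sqrt 2 *
           hermite_fun p h * hermite_fun (Suc l - p) g = a1 0 (Suc l) p (Suc l - p) * hermite_fun p h * hermite_fun (Suc l - p) g"
        by simp
    qed simp
  qed
next
  case (Suc k)
  have D: "((\<lambda>t. hermite_fun k ((h + t / sqrt 2 + (g + 1 * t / sqrt 2)) / sqrt 2) *
        hermite_fun l ((h + t / sqrt 2 - (g + 1 * t / sqrt 2)) / sqrt 2)) has_real_derivative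
      - (hermite_fun (Suc k) ((h + g) / sqrt 2) * hermite_fun l ((h - g) / sqrt 2))) (at 0)"
    unfolding mult_1_left rotate_plus by (auto intro!: derivative_eq_intros)
  show ?case
    unfolding hermite_fun_expansion_derivative[where F="\<lambda>h g. hermite_fun k ((h + g) / sqrt 2) * hermite_fun l ((h - g) / sqrt 2)", OF Suc.IH D] add_Suc
  proof (rule sum.cong)
    fix p assume "p \<in> {..Suc (k + l)}"
    then have "((if p = 0 then 0 else a1 k l (p - 1) (k + l - (p - 1))) + 1 * (if p = Suc (k + l) then 0 else a1 k l p (k + l - p)))
        = sqrt 2 * a1 (Suc k) l p (Suc (k + l) - p)"
      using a1_Suc_left[of p "Suc (k + l) - p" k l] by auto
    then show "((if p = 0 then 0 else a1 k l (p - 1) (k + l - (p - 1))) + 1 * (if p = Suc (k + l) then 0 else a1 k l p (k + l - p))) / sqrt 2 *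
         hermite_fun p h * hermite_fun (Suc (k + l) - p) g = a1 (Suc k) l p (Suc (k + l) - p) * hermite_fun p h * hermite_fun (Suc (k + l) - p) g"
      by simp
  qed simp
qed

lemma he_rotate:
  "poly (he k) ((h + g) / sqrt 2) * poly (he l) ((h - g) / sqrt 2) =
   (\<Sum>p\<le>k + l. a1 k l p (k + l - p) * poly (he p) h * poly (he (k + l - p)) g)"
proof -
  have "(poly (he k) ((h + g) / sqrt 2) * poly (he l) ((h - g) / sqrt 2)) * (gauss h * gauss g) =
      hermite_fun k ((h + g) / sqrt 2) * hermite_fun l ((h - g) / sqrt 2)"
    unfolding hermite_fun_def gauss_rotate[of h g, symmetric] by (simp only: mult_ac)
  also have "\<dots> =
   (\<Sum>p\<le>k + l. a1 k l p (k + l - p) * poly (he p) h * poly (he (k + l - p)) g) * (gauss h * gauss g)"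
    unfolding sum_distrib_right by (subst hermite_fun_rotate, intro sum.cong refl) (simp only: mult_ac hermite_fun_def)
  finally show ?thesis using gauss_pos[of h] gauss_pos[of g] by simp
qed

lemma he_rotate_single:
  "poly (he k) ((h + g) / sqrt 2) =
   2 powr (- real k / 2) * (\<Sum>p\<le>k. real (k choose p) * poly (he p) h * poly (he (k - p)) g)"
  using he_rotate[of k h g 0] by (simp add: a1_zero_right sum_distrib_left mult_ac)

section \<open>Gaussian decay and integration on the line\<close>

lemma power_abs_le_exp: "\<bar>x\<bar> ^ n \<le> fact n * exp \<bar>x::real\<bar>"
proof -
  have "\<bar>x\<bar> ^ n / fact n \<le> exp \<bar>x\<bar>"
    using sum_le_suminf[OF summable_exp[of "\<bar>x\<bar>"], of "{n}"] by (simp add: exp_def divide_inverse mult.commute scaleR_conv_of_real)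
  then show ?thesis by (simp add: field_simps)
qed

lemma exp_abs_le: "exp \<bar>x::real\<bar> \<le> exp 1 * exp (x\<^sup>2 / 4)"
proof -
  have "0 \<le> (\<bar>x\<bar> / 2 - 1)\<^sup>2" by simp
  also have "\<dots> = x\<^sup>2 / 4 - \<bar>x\<bar> + 1" by (simp add: power2_diff power_divide)
  finally have "\<bar>x\<bar> \<le> 1 + x\<^sup>2 / 4" by simp
  then show ?thesis by (simp flip: exp_add)
qed

text \<open>
  One half of the Gaussian exponent absorbs the polynomial, the other half is kept as decay.
\<close>

lemma poly_gauss_bound: "\<exists>C\<ge>0. \<forall>x. \<bar>poly p x * gauss x\<bar> \<le> C * exp (- x\<^sup>2 / 4)"
proof -
  have "\<bar>poly p x * gauss x\<bar> \<le> (\<Sum>i\<le>degree p. \<bar>coeff p i\<bar> * fact i * exp 1) * exp (- x\<^sup>2 / 4)" for x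
  proof -
    have "gauss x \<le> exp (- x\<^sup>2 / 2)"
      unfolding std_normal_density_def using pi_gt3 by (simp add: divide_le_eq mult_le_cancel_left1 field_simps)
    moreover have "\<bar>poly p x\<bar> \<le> (\<Sum>i\<le>degree p. \<bar>coeff p i\<bar> * fact i * exp 1) * exp (x\<^sup>2 / 4)"
    proof -
      have "\<bar>poly p x\<bar> \<le> (\<Sum>i\<le>degree p. \<bar>coeff p i\<bar> * \<bar>x\<bar> ^ i)"
        unfolding poly_altdef by (rule order.trans[OF sum_abs]) (simp add: abs_mult power_abs)
      also have "\<dots> \<le> (\<Sum>i\<le>degree p. \<bar>coeff p i\<bar> * (fact i * (exp 1 * exp (x\<^sup>2 / 4))))"
      proof (intro sum_mono mult_left_mono)
        fix i
        have "fact i * exp \<bar>x\<bar> \<le> fact i * (exp 1 * exp (x\<^sup>2 / 4))"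
          by (intro mult_left_mono exp_abs_le) simp
        then show "\<bar>x\<bar> ^ i \<le> fact i * (exp 1 * exp (x\<^sup>2 / 4))"
          using power_abs_le_exp[of x i] by linarith
      qed simp
      also have "\<dots> = (\<Sum>i\<le>degree p. \<bar>coeff p i\<bar> * fact i * exp 1) * exp (x\<^sup>2 / 4)"
        unfolding sum_distrib_right by (simp only: mult.assoc)
      finally show ?thesis .
    qed
    ultimately have "\<bar>poly p x\<bar> * gauss x \<le> (\<Sum>i\<le>degree p. \<bar>coeff p i\<bar> * fact i * exp 1) * exp (x\<^sup>2 / 4) * exp (- x\<^sup>2 / 2)"
      using gauss_pos[of x] by (intro mult_mono) (auto intro!: mult_nonneg_nonneg sum_nonneg)
    also have "\<dots> = (\<Sum>i\<le>degree p. \<bar>coeff p i\<bar> * fact i * exp 1) * exp (- x\<^sup>2 / 4)"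
      by (simp add: mult.assoc flip: exp_add)
    finally show ?thesis using gauss_pos[of x] by (simp add: abs_mult)
  qed
  moreover have "(\<Sum>i\<le>degree p. \<bar>coeff p i\<bar> * fact i * exp 1) \<ge> 0" by (intro sum_nonneg) simp
  ultimately show ?thesis by blast
qed

lemma integrable_exp_square:
  assumes "c > 0" shows "integrable lborel (\<lambda>x::real. exp (- c * x\<^sup>2))"
proof -
  have "integrable lborel (\<lambda>x. gauss (0 + sqrt (2 * c) * x))"
    by (rule lborel_integrable_real_affine, rule integrable_normal_density) (use assms in simp_all)
  from integrable_mult_right[OF this, of "sqrt (2 * pi)"]
  have "integrable lborel (\<lambda>x. sqrt (2 * pi) * gauss (0 + sqrt (2 * c) * x))" .
  moreover have "sqrt (2 * pi) * gauss (0 + sqrt (2 * c) * x) = exp (- c * x\<^sup>2)" for x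
  proof -
    have "(0 + sqrt (2 * c) * x)\<^sup>2 = 2 * (c * x\<^sup>2)" using assms by (simp add: power_mult_distrib)
    then show ?thesis unfolding std_normal_density_def by simp
  qed
  ultimately show ?thesis by (simp only:)
qed

lemma integrable_exp_quarter: "integrable lborel (\<lambda>x::real. exp (- x\<^sup>2 / 4))"
  using integrable_exp_square[of "1/4"] by simp

lemma gaussian_decay_integrable:
  fixes f :: "real \<Rightarrow> real"
  assumes [measurable]: "f \<in> borel_measurable borel" and "\<And>x. \<bar>f x\<bar> \<le> C * exp (- x\<^sup>2 / 4)"
  shows "integrable lborel f"
proof (rule Bochner_Integration.integrable_bound[OF integrable_mult_right[OF integrable_exp_quarter, of C]])
  have "norm (f x) \<le> norm (C * exp (- x\<^sup>2 / 4))" for x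
    using order.trans[OF assms(2)[of x] abs_ge_self] by (simp only: real_norm_def)
  then show "AE x in lborel. norm (f x) \<le> norm (C * exp (- x\<^sup>2 / 4))" by blast
qed simp

lemma gaussian_decay_at_infinity:
  fixes f :: "real \<Rightarrow> real"
  assumes "\<And>x. \<bar>f x\<bar> \<le> C * exp (- x\<^sup>2 / 4)"
  shows "(f \<longlongrightarrow> 0) at_top" "(f \<longlongrightarrow> 0) at_bot"
proof -
  have "((\<lambda>x::real. C * exp (- x\<^sup>2 / 4)) \<longlongrightarrow> 0) at_top" "((\<lambda>x::real. C * exp (- x\<^sup>2 / 4)) \<longlongrightarrow> 0) at_bot"
    by real_asymp+
  note lim = this
  show "(f \<longlongrightarrow> 0) at_top"
    by (rule Lim_null_comparison[OF always_eventually lim(1)]) (use assms in simp)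
  show "(f \<longlongrightarrow> 0) at_bot"
    by (rule Lim_null_comparison[OF always_eventually lim(2)]) (use assms in simp)
qed

text \<open>
  This is integration by parts on the line: the products that occur below decay, so that there are no
  boundary terms.
\<close>

lemma integral_derivative_gaussian_decay:
  fixes f :: "real \<Rightarrow> real"
  assumes D: "\<And>x. (f has_real_derivative f' x) (at x)"
    and cont: "continuous_on UNIV f'"
    and b: "\<And>x. \<bar>f x\<bar> \<le> C * exp (- x\<^sup>2 / 4)" and b': "\<And>x. \<bar>f' x\<bar> \<le> C' * exp (- x\<^sup>2 / 4)"
  shows "(\<integral>x. f' x \<partial>lborel) = 0"
proof -
  have "integrable lborel f'"
    by (rule gaussian_decay_integrable[OF _ b']) (use cont in \<open>simp add: borel_measurable_continuous_onI\<close>)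
  \<comment> \<open>The fundamental theorem of calculus on the whole line, with limits \<open>0\<close> at both ends.\<close>
  then have "(LBINT x=-\<infinity>..\<infinity>. f' x) = 0 - 0"
    by (intro interval_integral_FTC_integrable[where F = f])
      (use D cont gaussian_decay_at_infinity[of f, OF b] in
        \<open>auto simp: set_integrable_def has_real_derivative_iff_has_vector_derivative[symmetric]
          ereal_tendsto_simps continuous_on_eq_continuous_at\<close>)
  then show ?thesis
    by (simp add: interval_lebesgue_integral_def set_lebesgue_integral_def)
qed

text \<open>
  The integrand of a one-dimensional factor of the function \<open>J\<close> of the introduction; the name refers to
  the three Hermite factors.
\<close>

definition triple_integrand :: "nat \<Rightarrow> nat \<Rightarrow> nat \<Rightarrow> real \<Rightarrow> real \<Rightarrow> real" where
  "triple_integrand a k l u x = poly (he a) x * hermite_fun k x * hermite_fun l (x - u)"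

definition triple_integral :: "nat \<Rightarrow> nat \<Rightarrow> nat \<Rightarrow> real \<Rightarrow> real" where
  "triple_integral a k l u = (\<integral>x. triple_integrand a k l u x \<partial>lborel)"

text \<open>
  The quadratic form \<open>x\<^sup>2 + (x - u)\<^sup>2\<close> is positive definite, so decay in \<open>x\<close> and \<open>x - u\<close> is decay in
  \<open>x\<close> and \<open>u\<close>, at a smaller rate.
\<close>

lemma gaussian_product_le:
  "exp (- x\<^sup>2 / 4) * exp (- (x - u)\<^sup>2 / 4) \<le> exp (- x\<^sup>2 / 16) * exp (- u\<^sup>2 / (16::real))"
proof -
  have "x\<^sup>2 / 16 + u\<^sup>2 / 16 \<le> x\<^sup>2 / 4 + (x - u)\<^sup>2 / 4"
  proof -
    have "16 * (x\<^sup>2 / 4 + (x - u)\<^sup>2 / 4 - x\<^sup>2 / 16 - u\<^sup>2 / 16) = 7 * x\<^sup>2 - 8 * x * u + 3 * u\<^sup>2"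
      by (simp add: power2_eq_square field_simps)
    also have "\<dots> = 3 * (u - 4/3 * x)\<^sup>2 + 5/3 * x\<^sup>2"
      by (simp add: power2_eq_square algebra_simps)
    also have "\<dots> \<ge> 0" by simp
    finally show ?thesis by simp
  qed
  then show ?thesis by (simp flip: exp_add)
qed

lemma hermite_fun_bound: obtains C where "C \<ge> 0" "\<And>x. \<bar>hermite_fun n x\<bar> \<le> C * exp (- x\<^sup>2 / 4)"
proof -
  obtain C where "C \<ge> 0 \<and> (\<forall>x. \<bar>poly (he n) x * gauss x\<bar> \<le> C * exp (- x\<^sup>2 / 4))"
    using poly_gauss_bound[of "he n"] by (elim exE)
  then show ?thesis by (intro that[of C]) (simp_all add: hermite_fun_def)
qed

lemma he_hermite_fun_bound:
  obtains C where "C \<ge> 0" "\<And>x. \<bar>poly (he a) x * hermite_fun n x\<bar> \<le> C * exp (- x\<^sup>2 / 4)"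
proof -
  obtain C where "C \<ge> 0 \<and> (\<forall>x. \<bar>poly (he a * he n) x * gauss x\<bar> \<le> C * exp (- x\<^sup>2 / 4))"
    using poly_gauss_bound[of "he a * he n"] by (elim exE)
  then show ?thesis by (intro that[of C]) (simp_all add: hermite_fun_def mult.assoc)
qed

text \<open>
  Joint decay in both variables, which makes Fubini's theorem applicable.
\<close>

lemma triple_integrand_bound:
  obtains C where "C \<ge> 0"
    "\<And>u x. \<bar>triple_integrand a k l u x\<bar> \<le> C * (exp (- x\<^sup>2 / 16) * exp (- u\<^sup>2 / 16))"
proof -
  obtain C1 where C1: "C1 \<ge> 0" "\<And>x. \<bar>poly (he a) x * hermite_fun k x\<bar> \<le> C1 * exp (- x\<^sup>2 / 4)" by (rule he_hermite_fun_bound[of "a" "k"]) blast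
  obtain C2 where C2: "C2 \<ge> 0" "\<And>x. \<bar>hermite_fun l x\<bar> \<le> C2 * exp (- x\<^sup>2 / 4)" by (rule hermite_fun_bound[of "l"]) blast
  have "\<bar>triple_integrand a k l u x\<bar> \<le> C1 * C2 * (exp (- x\<^sup>2 / 16) * exp (- u\<^sup>2 / 16))" for u x
  proof -
    have "\<bar>triple_integrand a k l u x\<bar> \<le> (C1 * exp (- x\<^sup>2 / 4)) * (C2 * exp (- (x - u)\<^sup>2 / 4))"
      unfolding triple_integrand_def abs_mult[of _ "hermite_fun l (x - u)"]
      by (intro mult_mono C1(2) C2(2)) (use C1(1) in auto)
    also have "\<dots> = C1 * C2 * (exp (- x\<^sup>2 / 4) * exp (- (x - u)\<^sup>2 / 4))" by simp
    also have "\<dots> \<le> C1 * C2 * (exp (- x\<^sup>2 / 16) * exp (- u\<^sup>2 / 16))"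
      by (intro mult_left_mono gaussian_product_le) (use C1 C2 in auto)
    finally show ?thesis .
  qed
  then show ?thesis using C1(1) C2(1) by (intro that[of "C1 * C2"]) auto
qed

text \<open>
  For fixed \<open>u\<close> the last factor is merely bounded, and the rate of the first two factors survives.
\<close>

lemma triple_integrand_decay:
  obtains C where "C \<ge> 0" "\<And>x. \<bar>triple_integrand a k l u x\<bar> \<le> C * exp (- x\<^sup>2 / 4)"
proof -
  obtain C1 where C1: "C1 \<ge> 0" "\<And>x. \<bar>poly (he a) x * hermite_fun k x\<bar> \<le> C1 * exp (- x\<^sup>2 / 4)" by (rule he_hermite_fun_bound[of "a" "k"]) blast
  obtain C2 where C2: "C2 \<ge> 0" "\<And>x. \<bar>hermite_fun l x\<bar> \<le> C2 * exp (- x\<^sup>2 / 4)" by (rule hermite_fun_bound[of "l"]) blast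
  have "\<bar>triple_integrand a k l u x\<bar> \<le> C1 * C2 * exp (- x\<^sup>2 / 4)" for x
  proof -
    have "C2 * exp (- (x - u)\<^sup>2 / 4) \<le> C2 * 1" using C2(1) by (intro mult_left_mono) auto
    then have "\<bar>hermite_fun l (x - u)\<bar> \<le> C2" using C2(2)[of "x - u"] by linarith
    then have "\<bar>triple_integrand a k l u x\<bar> \<le> (C1 * exp (- x\<^sup>2 / 4)) * C2"
      unfolding triple_integrand_def abs_mult[of _ "hermite_fun l (x - u)"]
      by (intro mult_mono C1(2)) (use C1(1) in auto)
    then show ?thesis by (simp add: mult_ac)
  qed
  then show ?thesis using C1(1) C2(1) by (intro that[of "C1 * C2"]) auto
qed

lemma continuous_on_triple_integrand: "continuous_on A (triple_integrand a k l u)"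
  unfolding triple_integrand_def by (intro continuous_intros)

lemma integrable_triple_integrand: "integrable lborel (triple_integrand a k l u)"
proof -
  obtain C where "C \<ge> 0" and "\<And>x. \<bar>triple_integrand a k l u x\<bar> \<le> C * exp (- x\<^sup>2 / 4)" by (rule triple_integrand_decay[of "a" "k" "l" "u"]) blast
  then show ?thesis
    by (intro gaussian_decay_integrable borel_measurable_continuous_onI continuous_on_triple_integrand)
qed

text \<open>
  The derivative of the integrand lowers the order of the polynomial or raises that of one of the two
  Hermite functions, and its integral is zero.
\<close>

lemma triple_integral_by_parts:
  "triple_integral a (Suc k) l u + triple_integral a k (Suc l) u = real a * triple_integral (a - 1) k l u"
proof -
  let ?f' = "\<lambda>x. real a * triple_integrand (a - 1) k l u x - triple_integrand a (Suc k) l u x - triple_integrand a k (Suc l) u x"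
  obtain C0 where "C0 \<ge> 0" and C0: "\<And>x. \<bar>triple_integrand a k l u x\<bar> \<le> C0 * exp (- x\<^sup>2 / 4)" by (rule triple_integrand_decay[of "a" "k" "l" "u"]) blast
  obtain C1 where "C1 \<ge> 0" and C1: "\<And>x. \<bar>triple_integrand (a - 1) k l u x\<bar> \<le> C1 * exp (- x\<^sup>2 / 4)" by (rule triple_integrand_decay[of "a - 1" "k" "l" "u"]) blast
  obtain C2 where "C2 \<ge> 0" and C2: "\<And>x. \<bar>triple_integrand a (Suc k) l u x\<bar> \<le> C2 * exp (- x\<^sup>2 / 4)" by (rule triple_integrand_decay[of "a" "Suc k" "l" "u"]) blast
  obtain C3 where "C3 \<ge> 0" and C3: "\<And>x. \<bar>triple_integrand a k (Suc l) u x\<bar> \<le> C3 * exp (- x\<^sup>2 / 4)" by (rule triple_integrand_decay[of "a" "k" "Suc l" "u"]) blast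
  have "(\<integral>x. ?f' x \<partial>lborel) = 0"
  proof (rule integral_derivative_gaussian_decay)
    show "(triple_integrand a k l u has_real_derivative ?f' x) (at x)" for x
      unfolding triple_integrand_def
      by (auto intro!: derivative_eq_intros poly_DERIV simp: pderiv_he algebra_simps)
    show "continuous_on UNIV ?f'" by (intro continuous_intros continuous_on_triple_integrand)
    show "\<bar>triple_integrand a k l u x\<bar> \<le> C0 * exp (- x\<^sup>2 / 4)" for x by (rule C0)
    show "\<bar>?f' x\<bar> \<le> (real a * C1 + C2 + C3) * exp (- x\<^sup>2 / 4)" for x
    proof -
      have "\<bar>?f' x\<bar> \<le> real a * \<bar>triple_integrand (a - 1) k l u x\<bar> + \<bar>triple_integrand a (Suc k) l u x\<bar> + \<bar>triple_integrand a k (Suc l) u x\<bar>"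
        by (rule order.trans[OF abs_triangle_ineq4] order.trans[OF add_right_mono[OF abs_triangle_ineq4]])+ (simp add: abs_mult)
      also have "\<dots> \<le> real a * (C1 * exp (- x\<^sup>2 / 4)) + C2 * exp (- x\<^sup>2 / 4) + C3 * exp (- x\<^sup>2 / 4)"
        by (intro add_mono mult_left_mono C1 C2 C3) simp
      finally show ?thesis by (simp add: algebra_simps)
    qed
  qed
  then show ?thesis by (simp add: triple_integral_def integrable_triple_integrand)
qed

lemma integrable_he_hermite_fun: "integrable lborel (\<lambda>x. poly (he m) x * hermite_fun n x)"
proof -
  obtain C where "C \<ge> 0" and "\<And>x. \<bar>poly (he m) x * hermite_fun n x\<bar> \<le> C * exp (- x\<^sup>2 / 4)" by (rule he_hermite_fun_bound[of "m" "n"]) blast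
  then show ?thesis by (intro gaussian_decay_integrable) auto
qed

text \<open>
  Integration by parts moves a derivative from the Hermite function to the polynomial.
\<close>

lemma hermite_orthogonality_step:
  "(\<integral>x. poly (he m) x * hermite_fun (Suc n) x \<partial>lborel) = real m * (\<integral>x. poly (he (m - 1)) x * hermite_fun n x \<partial>lborel)"
proof -
  let ?f' = "\<lambda>x. real m * (poly (he (m - 1)) x * hermite_fun n x) - poly (he m) x * hermite_fun (Suc n) x"
  obtain C0 where "C0 \<ge> 0" and C0: "\<And>x. \<bar>poly (he m) x * hermite_fun n x\<bar> \<le> C0 * exp (- x\<^sup>2 / 4)" by (rule he_hermite_fun_bound[of "m" "n"]) blast
  obtain C1 where "C1 \<ge> 0" and C1: "\<And>x. \<bar>poly (he (m - 1)) x * hermite_fun n x\<bar> \<le> C1 * exp (- x\<^sup>2 / 4)" by (rule he_hermite_fun_bound[of "m - 1" "n"]) blast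
  obtain C2 where "C2 \<ge> 0" and C2: "\<And>x. \<bar>poly (he m) x * hermite_fun (Suc n) x\<bar> \<le> C2 * exp (- x\<^sup>2 / 4)" by (rule he_hermite_fun_bound[of "m" "Suc n"]) blast
  have "(\<integral>x. ?f' x \<partial>lborel) = 0"
  proof (rule integral_derivative_gaussian_decay)
    show "((\<lambda>x. poly (he m) x * hermite_fun n x) has_real_derivative ?f' x) (at x)" for x
      by (auto intro!: derivative_eq_intros poly_DERIV simp: pderiv_he algebra_simps)
    show "continuous_on UNIV ?f'" by (intro continuous_intros)
    show "\<bar>poly (he m) x * hermite_fun n x\<bar> \<le> C0 * exp (- x\<^sup>2 / 4)" for x by (rule C0)
    show "\<bar>?f' x\<bar> \<le> (real m * C1 + C2) * exp (- x\<^sup>2 / 4)" for x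
    proof -
      have "\<bar>?f' x\<bar> \<le> real m * \<bar>poly (he (m - 1)) x * hermite_fun n x\<bar> + \<bar>poly (he m) x * hermite_fun (Suc n) x\<bar>"
        by (rule order.trans[OF abs_triangle_ineq4]) (simp add: abs_mult)
      also have "\<dots> \<le> real m * (C1 * exp (- x\<^sup>2 / 4)) + C2 * exp (- x\<^sup>2 / 4)"
        by (intro add_mono mult_left_mono C1 C2) simp
      finally show ?thesis by (simp add: algebra_simps)
    qed
  qed
  then show ?thesis by (simp add: integrable_he_hermite_fun)
qed

lemma hermite_orthogonality:
  "(\<integral>x. poly (he m) x * hermite_fun n x \<partial>lborel) = (if m = n then fact n else 0)"
proof (induction n arbitrary: m)
  case 0
  show ?case
  proof (cases m)
    case 0
    then show ?thesis by (simp add: hermite_fun_def)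
  next
    case (Suc j)
    have "(\<integral>x. poly (he m) x * hermite_fun 0 x \<partial>lborel) = (\<integral>x. poly (he 0) x * hermite_fun (Suc j) x \<partial>lborel)"
      by (intro Bochner_Integration.integral_cong) (simp_all add: hermite_fun_def Suc)
    also have "\<dots> = 0" by (subst hermite_orthogonality_step) simp
    finally show ?thesis using Suc by simp
  qed
next
  case (Suc n)
  then show ?case
    unfolding hermite_orthogonality_step by (cases m) auto
qed

text \<open>
  The substitution \<open>x = (h + g) / \<surd>2\<close> turns the arguments \<open>x\<close> and \<open>x - \<surd>2 g\<close> into the rotated pair. One
  expansion in \<open>h\<close> comes from the polynomial, of degrees \<open>p \<le> a\<close>, and one from the two Hermite functions,
  of orders \<open>p' \<le> k + l\<close>; orthogonality keeps \<open>p = p'\<close>.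
\<close>

lemma triple_integral_rotate:
  "triple_integral a k l (sqrt 2 * g) = 2 powr (- real (Suc a) / 2) *
     (\<Sum>p\<le>min a (k + l). fact a / fact (a - p) * a1 k l p (k + l - p) * (poly (he (a - p)) g * poly (he (k + l - p)) g * gauss g))"
proof -
  let ?c = "\<lambda>p. real (a choose p) * poly (he (a - p)) g"
  let ?d = "\<lambda>p. a1 k l p (k + l - p) * hermite_fun (k + l - p) g"
  have int: "integrable lborel (\<lambda>h. poly (he p) h * hermite_fun p' h)" for p p' by (rule integrable_he_hermite_fun)
  have "triple_integral a k l (sqrt 2 * g) = (\<integral>h. triple_integrand a k l (sqrt 2 * g) (g / sqrt 2 + (1 / sqrt 2) * h) \<partial>lborel) / sqrt 2"
    unfolding triple_integral_def by (subst lborel_integral_real_affine[of "1 / sqrt 2" _ "g / sqrt 2"]) auto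
  also have "(\<lambda>h. triple_integrand a k l (sqrt 2 * g) (g / sqrt 2 + (1 / sqrt 2) * h)) =
     (\<lambda>h. 2 powr (- real a / 2) * (\<Sum>p\<le>a. \<Sum>p'\<le>k + l. ?c p * ?d p' * (poly (he p) h * hermite_fun p' h)))"
  proof
    fix h
    have e: "g / sqrt 2 + (1 / sqrt 2) * h = (h + g) / sqrt 2" by (simp add: add_divide_distrib)
    have e': "(h + g) / sqrt 2 - sqrt 2 * g = (h - g) / sqrt 2" by (simp add: field_simps)
    show "triple_integrand a k l (sqrt 2 * g) (g / sqrt 2 + (1 / sqrt 2) * h) = 2 powr (- real a / 2) * (\<Sum>p\<le>a. \<Sum>p'\<le>k + l. ?c p * ?d p' * (poly (he p) h * hermite_fun p' h))"
      unfolding triple_integrand_def e e' mult.assoc hermite_fun_rotate he_rotate_single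
      unfolding sum_product by (simp add: mult_ac)
  qed
  also have "(\<integral>h. 2 powr (- real a / 2) * (\<Sum>p\<le>a. \<Sum>p'\<le>k + l. ?c p * ?d p' * (poly (he p) h * hermite_fun p' h)) \<partial>lborel) =
      2 powr (- real a / 2) * (\<Sum>p\<le>a. \<Sum>p'\<le>k + l. ?c p * ?d p' * (if p = p' then fact p' else 0))"
    by (simp add: int hermite_orthogonality)
  also have "(\<Sum>p\<le>a. \<Sum>p'\<le>k + l. ?c p * ?d p' * (if p = p' then fact p' else 0)) = (\<Sum>p\<le>a. if p \<le> k + l then ?c p * ?d p * fact p else 0)"
    by (intro sum.cong refl) (auto simp: if_distrib[where f = "\<lambda>x. _ * x"] sum.delta' cong: if_cong)
  also have "\<dots> = (\<Sum>p\<le>min a (k + l). ?c p * ?d p * fact p)"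
    by (intro sum.mono_neutral_cong_right) auto
  also have "\<dots> = (\<Sum>p\<le>min a (k + l). fact a / fact (a - p) * a1 k l p (k + l - p) * (poly (he (a - p)) g * poly (he (k + l - p)) g * gauss g))"
    by (intro sum.cong refl) (simp add: binomial_fact hermite_fun_def)
  finally show ?thesis unfolding two_powr_half_Suc by simp
qed

section \<open>Integrals over the three-dimensional space\<close>

text \<open>
  Lebesgue measure on \<open>real ^ 'n\<close> is the image of a product measure indexed by the standard basis; the
  proof only translates between basis vectors and coordinate indices.
\<close>

lemma integral_prod_components:
  fixes f :: "'n::finite \<Rightarrow> real \<Rightarrow> real"
  assumes f: "\<And>i. integrable lborel (f i)"
  shows integrable_prod_components: "integrable lborel (\<lambda>v::real^'n. \<Prod>i\<in>UNIV. f i (v $ i))"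
    and "(\<integral>v. (\<Prod>i\<in>UNIV. f i (v $ i)) \<partial>(lborel :: (real^'n) measure)) = (\<Prod>i\<in>UNIV. \<integral>x. f i x \<partial>lborel)"
proof -
  interpret product_sigma_finite "\<lambda>_::real^'n. lborel :: real measure" ..
  let ?e = "\<lambda>i::'n. axis i (1::real)"
  have inj: "inj ?e" by (simp add: inj_on_def axis_eq_axis)
  have B: "(Basis :: (real^'n) set) = range ?e" by (auto simp: Basis_vec_def)
  define F where "F b = f (inv ?e b)" for b
  have F: "F (?e i) = f i" for i by (simp add: F_def inv_f_f[OF inj])
  have comp: "(\<Sum>b\<in>Basis. x b *\<^sub>R b) $ i = x (?e i)" for x and i :: 'n
  proof -
    have "(\<Sum>b\<in>Basis. x b *\<^sub>R b) $ i = (\<Sum>b\<in>Basis. x b *\<^sub>R b) \<bullet> ?e i" by (simp add: inner_axis)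
    also have "\<dots> = x (?e i)" by (rule inner_sum_left_Basis) (simp add: B)
    finally show ?thesis .
  qed
  have prod: "(\<Prod>i\<in>UNIV. f i ((\<Sum>b\<in>Basis. x b *\<^sub>R b) $ i)) = (\<Prod>b\<in>Basis. F b (x b))" for x
    unfolding comp unfolding B by (subst prod.reindex[OF inj]) (simp add: F)
  have [measurable]: "f i \<in> borel_measurable borel" for i using f[of i] by (auto dest: borel_measurable_integrable)
  have [measurable]: "(\<lambda>v::real^'n. \<Prod>i\<in>UNIV. f i (v $ i)) \<in> borel_measurable borel" by measurable
  have int: "integrable lborel (F b)" for b by (simp add: F_def f)
  have "integrable (\<Pi>\<^sub>M b\<in>Basis. lborel) (\<lambda>x. \<Prod>b\<in>Basis. F b (x b))"
    by (rule product_integrable_prod) (auto intro: int)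
  then show "integrable lborel (\<lambda>v::real^'n. \<Prod>i\<in>UNIV. f i (v $ i))"
    by (subst lborel_eq, subst integrable_distr_eq) (simp_all only: prod, measurable)
  have "(\<integral>v. (\<Prod>i\<in>UNIV. f i (v $ i)) \<partial>(lborel :: (real^'n) measure)) = (\<integral>x. (\<Prod>b\<in>Basis. F b (x b)) \<partial>(\<Pi>\<^sub>M b\<in>(Basis::(real^'n) set). lborel))"
    by (subst lborel_eq, subst integral_distr) (simp_all only: prod, measurable)
  also have "\<dots> = (\<Prod>b\<in>(Basis::(real^'n) set). \<integral>x. F b x \<partial>lborel)"
    by (rule product_integral_prod) (auto intro: int)
  also have "\<dots> = (\<Prod>i\<in>UNIV. \<integral>x. f i x \<partial>lborel)"
    unfolding B by (subst prod.reindex[OF inj]) (simp add: F)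
  finally show "(\<integral>v. (\<Prod>i\<in>UNIV. f i (v $ i)) \<partial>(lborel :: (real^'n) measure)) = (\<Prod>i\<in>UNIV. \<integral>x. f i x \<partial>lborel)" .
qed

lemma norm_vec_power2: "(norm v)\<^sup>2 = (\<Sum>i\<in>UNIV. (v $ i)\<^sup>2)" for v :: "real^'n"
  unfolding power2_norm_eq_inner inner_vec_def by (simp add: power2_eq_square)

lemma exp_norm_vec: "exp (c * (norm v)\<^sup>2) = (\<Prod>i\<in>UNIV. exp (c * (v $ i)\<^sup>2))" for v :: "real^'n"
  by (simp add: norm_vec_power2 sum_distrib_left exp_sum)

lemma prod_abs_bound:
  fixes f g :: "'i::finite \<Rightarrow> 'x \<Rightarrow> real"
  assumes "\<And>i. \<exists>C\<ge>0. \<forall>x. \<bar>f i x\<bar> \<le> C * g i x"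
  obtains C where "C \<ge> 0" "\<And>x. \<bar>\<Prod>i\<in>UNIV. f i x\<bar> \<le> C * (\<Prod>i\<in>UNIV. g i x)"
proof -
  obtain C where C: "\<And>i. C i \<ge> 0" "\<And>i x. \<bar>f i x\<bar> \<le> C i * g i x" using assms by metis
  show ?thesis
  proof (rule that)
    show "(\<Prod>i\<in>UNIV. C i) \<ge> 0" by (intro prod_nonneg) (auto simp: C)
    show "\<bar>\<Prod>i\<in>UNIV. f i x\<bar> \<le> (\<Prod>i\<in>UNIV. C i) * (\<Prod>i\<in>UNIV. g i x)" for x
      unfolding abs_prod prod.distrib[symmetric] by (intro prod_mono) (auto simp: C)
  qed
qed

text \<open>
  Completing the square bounds \<open>exp (- c x\<^sup>2)\<close> by a multiple of \<open>exp (- \<bar>x\<bar>)\<close>, and the integral becomes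
  two copies of Euler's integral for the Gamma function.
\<close>

lemma integrable_abs_powr_exp:
  assumes "b > -1" "c > 0"
  shows "integrable lborel (\<lambda>x::real. \<bar>x\<bar> powr b * exp (- c * x\<^sup>2))"
proof -
  let ?f = "\<lambda>x::real. indicator {0..} x * (x powr b * exp (- x))"
  have "(\<lambda>t. t powr (b + 1 - 1) / exp t) absolutely_integrable_on {0..}"
    using assms by (intro nonnegative_absolutely_integrable_1 has_integral_integrable[OF Gamma_integral_real]) auto
  then have f: "integrable lborel ?f"
    unfolding set_integrable_def by (simp add: integrable_completion exp_minus field_simps)
  have f': "integrable lborel (\<lambda>x. ?f (- x))"
    using lborel_integrable_real_affine[OF f, of "-1" 0] by simp
  have "integrable lborel (\<lambda>x. exp (1 / (4 * c)) * (?f x + ?f (- x)))"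
    by (intro integrable_mult_right Bochner_Integration.integrable_add f f')
  then show ?thesis
  proof (rule Bochner_Integration.integrable_bound)
    have "norm (\<bar>x\<bar> powr b * exp (- c * x\<^sup>2)) \<le> norm (exp (1 / (4 * c)) * (?f x + ?f (- x)))" for x
    proof (cases "x = 0")
      case False
      \<comment> \<open>The square is chosen to cancel the linear term \<open>\<bar>x\<bar>\<close>.\<close>
      have "0 \<le> c * (\<bar>x\<bar> - 1 / (2 * c))\<^sup>2" using assms by simp
      also have "\<dots> = c * x\<^sup>2 - \<bar>x\<bar> + 1 / (4 * c)"
        using assms by (simp add: power2_diff field_simps power2_eq_square)
      finally have "exp (- c * x\<^sup>2) \<le> exp (1 / (4 * c)) * exp (- \<bar>x\<bar>)" by (simp flip: exp_add)
      then have "\<bar>x\<bar> powr b * exp (- c * x\<^sup>2) \<le> \<bar>x\<bar> powr b * (exp (1 / (4 * c)) * exp (- \<bar>x\<bar>))"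
        by (intro mult_left_mono) auto
      also have "\<dots> = exp (1 / (4 * c)) * (?f x + ?f (- x))"
        using False by (auto simp: indicator_def)
      finally show ?thesis by simp
    qed simp
    then show "AE x in lborel. norm (\<bar>x\<bar> powr b * exp (- c * x\<^sup>2)) \<le> norm (exp (1 / (4 * c)) * (?f x + ?f (- x)))"
      by (intro always_eventually allI)
  qed simp
qed

text \<open>
  The singularity is shared equally among the coordinates: \<open>b > - 3\<close> in the space becomes \<open>b / 3 > - 1\<close>
  on each axis, and the integral becomes a product of integrals on the line.
\<close>

lemma norm_powr_le_prod:
  fixes v :: "real^3"
  assumes "b \<le> 0" "\<And>i. v $ i \<noteq> 0"
  shows "norm v powr b \<le> (\<Prod>i\<in>UNIV. \<bar>v $ i\<bar> powr (b / 3))"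
proof -
  have "norm v \<noteq> 0" using assms(2)[of 1] by auto
  have "norm v powr b = (\<Prod>i\<in>(UNIV::3 set). norm v powr (b / 3))"
    using \<open>norm v \<noteq> 0\<close> by (simp add: powr_power del: norm_eq_zero)
  also have "\<dots> \<le> (\<Prod>i\<in>UNIV. \<bar>v $ i\<bar> powr (b / 3))"
    using assms by (intro prod_mono conjI powr_mono2') (auto simp: component_le_norm_cart)
  finally show ?thesis .
qed

lemma AE_components_nonzero: "AE v in (lborel :: (real^'n) measure). \<forall>i. v $ i \<noteq> 0"
proof -
  have "AE v in (lborel :: (real^'n) measure). v $ i \<noteq> 0" for i
  proof -
    have "negligible {v :: real^'n. v $ i = 0}" by (rule negligible_standard_hyperplane_cart)
    moreover have "closed {v :: real^'n. v $ i = 0}" by (intro closed_Collect_eq continuous_intros)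
    ultimately have "{v :: real^'n. v $ i = 0} \<in> null_sets lborel"
      using negligible_iff_null_sets null_sets_completion_iff by (metis borel_closed sets_lborel)
    from AE_not_in[OF this] show ?thesis by simp
  qed
  then show ?thesis by (simp add: AE_all_countable)
qed

text \<open>
  For \<open>b \<le> 0\<close> the singularity is dominated coordinatewise. For \<open>b > 0\<close> only growth matters, and
  \<open>\<bar>v\<bar> powr b \<le> exp (b \<bar>v\<bar>)\<close> is absorbed by half of the Gaussian exponent.
\<close>

lemma integrable_norm_powr_gaussian:
  assumes "b > -3" "c > 0"
  shows "integrable lborel (\<lambda>v::real^3. norm v powr b * exp (- c * (norm v)\<^sup>2))"
proof (cases "b \<le> 0")
  case True
  have "integrable lborel (\<lambda>v::real^3. \<Prod>i\<in>UNIV. \<bar>v $ i\<bar> powr (b / 3) * exp (- c * (v $ i)\<^sup>2))"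
    by (rule integrable_prod_components, rule integrable_abs_powr_exp) (use assms in auto)
  then show ?thesis
  proof (rule Bochner_Integration.integrable_bound)
    show "AE v in (lborel :: (real^3) measure). norm (norm v powr b * exp (- c * (norm v)\<^sup>2)) \<le>
      norm (\<Prod>i\<in>UNIV. \<bar>v $ i\<bar> powr (b / 3) * exp (- c * (v $ i)\<^sup>2))"
      using AE_components_nonzero
    proof eventually_elim
      case (elim v)
      have "norm v powr b * exp (- c * (norm v)\<^sup>2) \<le> (\<Prod>i\<in>UNIV. \<bar>v $ i\<bar> powr (b / 3)) * exp (- c * (norm v)\<^sup>2)"
        using elim True by (intro mult_right_mono norm_powr_le_prod) auto
      then show ?case by (simp only: exp_norm_vec prod.distrib) (simp add: abs_mult prod_nonneg)
    qed
  qed simp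
next
  case False
  have "integrable lborel (\<lambda>v::real^3. exp (b\<^sup>2 / (2 * c)) * (\<Prod>i\<in>UNIV. exp (- (c / 2) * (v $ i)\<^sup>2)))"
    by (rule integrable_mult_right, rule integrable_prod_components, rule integrable_exp_square) (use assms in auto)
  then show ?thesis
  proof (rule Bochner_Integration.integrable_bound)
    have "norm (norm v powr b * exp (- c * (norm v)\<^sup>2)) \<le>
      norm (exp (b\<^sup>2 / (2 * c)) * (\<Prod>i\<in>UNIV. exp (- (c / 2) * (v $ i)\<^sup>2)))" for v :: "real^3"
    proof -
      have "norm v powr b \<le> exp (norm v) powr b"
        using False by (intro powr_mono2) (auto intro: order.trans[OF _ exp_ge_add_one_self])
      also have "\<dots> = exp (b * norm v)" by (simp add: powr_def)
      finally have "norm v powr b * exp (- c * (norm v)\<^sup>2) \<le> exp (b * norm v) * exp (- c * (norm v)\<^sup>2)"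
        by (intro mult_right_mono) auto
      also have "\<dots> = exp (b * norm v - c * (norm v)\<^sup>2)" by (simp add: exp_diff exp_minus field_simps)
      also have "\<dots> \<le> exp (b\<^sup>2 / (2 * c) + (- (c / 2) * (norm v)\<^sup>2))"
      proof -
        have "0 \<le> c / 2 * (norm v - b / c)\<^sup>2" using assms by simp
        also have "\<dots> = c / 2 * (norm v)\<^sup>2 - b * norm v + b\<^sup>2 / (2 * c)"
          using assms by (simp add: power2_diff field_simps power2_eq_square)
        finally show ?thesis by simp
      qed
      also have "\<dots> = exp (b\<^sup>2 / (2 * c)) * (\<Prod>i\<in>UNIV. exp (- (c / 2) * (v $ i)\<^sup>2))"
        unfolding exp_add exp_norm_vec ..
      finally show ?thesis by (simp add: abs_mult prod_nonneg)
    qed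
    then show "AE v in (lborel :: (real^3) measure). norm (norm v powr b * exp (- c * (norm v)\<^sup>2)) \<le>
      norm (exp (b\<^sup>2 / (2 * c)) * (\<Prod>i\<in>UNIV. exp (- (c / 2) * (v $ i)\<^sup>2)))"
      by (intro always_eventually allI)
  qed simp
qed

section \<open>Hermite functions of three variables\<close>

definition hermite_fun3 :: "multi_index \<Rightarrow> R3 \<Rightarrow> real" where
  "hermite_fun3 a v = (\<Prod>i\<in>UNIV. hermite_fun (a $ i) (v $ i))"

lemma maxwellian_eq_prod: "maxwellian v = (\<Prod>i\<in>UNIV. gauss (v $ i))"
proof -
  have "(\<Prod>i\<in>UNIV. gauss (v $ i)) = (1 / sqrt (2 * pi)) ^ 3 * exp (- 1 / 2 * (norm v)\<^sup>2)"
    unfolding exp_norm_vec std_normal_density_def by (simp add: prod_dividef power_divide)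
  also have "(1 / sqrt (2 * pi)) ^ 3 = (2 * pi) powr (- 3 / 2)"
  proof -
    have "1 / sqrt (2 * pi) = (2 * pi) powr (- 1 / 2)" by (simp add: powr_minus_divide powr_half_sqrt)
    then show ?thesis by (simp add: powr_power)
  qed
  finally show ?thesis by (simp add: maxwellian_def)
qed

lemma hermite_fun3_0: "hermite_fun3 0 = maxwellian"
  by (simp add: hermite_fun3_def maxwellian_eq_prod hermite_fun_def fun_eq_iff)

lemma maxwellian_pos: "maxwellian v > 0"
  unfolding maxwellian_eq_prod by (intro prod_pos) (simp add: gauss_pos)

lemma hermite_fun3_has_derivative:
  "((\<lambda>h. hermite_fun3 a (v + h *\<^sub>R axis i 1)) has_real_derivative
     - hermite_fun3 (a + unit_index i) (v + t *\<^sub>R axis i 1)) (at t)"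
proof -
  have split: "hermite_fun3 b (v + h *\<^sub>R axis i 1) = hermite_fun (b $ i) (v $ i + h) * (\<Prod>j\<in>UNIV - {i}. hermite_fun (b $ j) (v $ j))" for b h
  proof -
    have "hermite_fun3 b (v + h *\<^sub>R axis i 1) = hermite_fun (b $ i) ((v + h *\<^sub>R axis i 1) $ i) *
        (\<Prod>j\<in>UNIV - {i}. hermite_fun (b $ j) ((v + h *\<^sub>R axis i 1) $ j))"
      unfolding hermite_fun3_def by (rule prod.remove) auto
    also have "(\<Prod>j\<in>UNIV - {i}. hermite_fun (b $ j) ((v + h *\<^sub>R axis i 1) $ j)) = (\<Prod>j\<in>UNIV - {i}. hermite_fun (b $ j) (v $ j))"
      by (intro prod.cong) (auto simp: axis_def)
    finally show ?thesis by simp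
  qed
  have "(\<Prod>j\<in>UNIV - {i}. hermite_fun ((a + unit_index i) $ j) (v $ j)) = (\<Prod>j\<in>UNIV - {i}. hermite_fun (a $ j) (v $ j))"
    by (intro prod.cong) (auto simp: axis_def)
  then show ?thesis
    unfolding split by (auto intro!: derivative_eq_intros)
qed

lemma partial_deriv_hermite_fun3:
  "partial_deriv i (\<lambda>v. c * hermite_fun3 a v) = (\<lambda>v. - c * hermite_fun3 (a + unit_index i) v)"
proof
  fix v
  have "((\<lambda>h. c * hermite_fun3 a (v + h *\<^sub>R axis i 1)) has_real_derivative - c * hermite_fun3 (a + unit_index i) v) (at 0)"
    using DERIV_cmult[OF hermite_fun3_has_derivative[of a v i 0], of c] by simp
  then show "partial_deriv i (\<lambda>v. c * hermite_fun3 a v) v = - c * hermite_fun3 (a + unit_index i) v"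
    unfolding partial_deriv_def by (rule DERIV_imp_deriv)
qed

lemma iterated_partial_deriv_hermite_fun3:
  "(partial_deriv i ^^ n) (\<lambda>v. c * hermite_fun3 a v) = (\<lambda>v. (-1) ^ n * c * hermite_fun3 (a + axis i n) v)"
proof (induction n)
  case 0
  then show ?case by (simp add: axis_def zero_vec_def[symmetric])
next
  case (Suc n)
  have "a + axis i n + unit_index i = a + axis i (Suc n)" by (simp add: vec_eq_iff axis_def)
  then show ?case by (simp add: Suc partial_deriv_hermite_fun3)
qed

text \<open>
  The Maxwellian is the Hermite function of order zero, and each partial derivative raises the order
  and changes the sign.
\<close>

lemma mixed_partial_maxwellian: "mixed_partial a maxwellian = (\<lambda>v. (-1) ^ mi_abs a * hermite_fun3 a v)"
proof -
  have "(partial_deriv 3 ^^ (a $ 3)) maxwellian = (\<lambda>v. (-1) ^ (a $ 3) * hermite_fun3 (axis 3 (a $ 3)) v)"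
    using iterated_partial_deriv_hermite_fun3[of "a $ 3" 3 1 0] by (simp add: hermite_fun3_0)
  then have "mixed_partial a maxwellian = (\<lambda>v. (-1) ^ (a $ 1) * ((-1) ^ (a $ 2) * (-1) ^ (a $ 3)) *
      hermite_fun3 (axis 3 (a $ 3) + axis 2 (a $ 2) + axis 1 (a $ 1)) v)"
    by (simp only: mixed_partial_def iterated_partial_deriv_hermite_fun3)
  also have "axis 3 (a $ 3) + axis 2 (a $ 2) + axis 1 (a $ 1) = a"
    by (simp add: vec_eq_iff axis_def forall_3)
  also have "(-1) ^ (a $ 1) * ((-1) ^ (a $ 2) * (-1) ^ (a $ 3)) = (-1 :: real) ^ mi_abs a"
    by (simp add: mi_abs_def sum_3 power_add)
  finally show ?thesis .
qed

lemma hermite_times_maxwellian: "hermite a v * maxwellian v = hermite_fun3 a v"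
  using maxwellian_pos[of v]
  by (simp add: hermite_def mixed_partial_maxwellian flip: power_mult_distrib)

lemma hermite_eq_prod: "hermite a v = (\<Prod>i\<in>UNIV. poly (he (a $ i)) (v $ i))"
proof -
  have "hermite a v * maxwellian v = (\<Prod>i\<in>UNIV. poly (he (a $ i)) (v $ i)) * maxwellian v"
    unfolding hermite_times_maxwellian
    unfolding maxwellian_eq_prod hermite_fun3_def hermite_fun_def prod.distrib ..
  then show ?thesis using maxwellian_pos[of v] by simp
qed

lemma grad_hermite_fun3: "grad (hermite_fun3 a) v = (\<chi> i. - hermite_fun3 (a + unit_index i) v)"
  using partial_deriv_hermite_fun3[of _ 1 a] by (simp add: grad_def)

lemma borel_measurable_hermite_fun3 [measurable]: "hermite_fun3 a \<in> borel_measurable borel"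
  unfolding hermite_fun3_def by measurable

lemma borel_measurable_hermite [measurable]: "hermite a \<in> borel_measurable borel"
  unfolding hermite_eq_prod[abs_def] by measurable

lemma hermite_fun3_bound:
  obtains C where "C \<ge> 0" "\<And>v. \<bar>hermite_fun3 a v\<bar> \<le> C * exp (- (norm v)\<^sup>2 / 4)"
proof -
  have "\<exists>C\<ge>0. \<forall>v::R3. \<bar>hermite_fun (a $ i) (v $ i)\<bar> \<le> C * exp (- 1 / 4 * (v $ i)\<^sup>2)" for i
    by (rule hermite_fun_bound[of "a $ i"]) auto
  from prod_abs_bound[of "\<lambda>i v. hermite_fun (a $ i) (v $ i)" "\<lambda>i v. exp (- 1 / 4 * (v $ i)\<^sup>2)", OF this]
  obtain C where C: "C \<ge> 0" "\<And>v. \<bar>hermite_fun3 a v\<bar> \<le> C * (\<Prod>i\<in>UNIV. exp (- 1 / 4 * (v $ i)\<^sup>2))"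
    unfolding hermite_fun3_def by blast
  have "(\<Prod>i\<in>UNIV. exp (- 1 / 4 * (v $ i)\<^sup>2)) = exp (- (norm v)\<^sup>2 / 4)" for v :: R3
    unfolding exp_norm_vec[symmetric] by simp
  then show ?thesis using that[OF C(1)] C(2) by simp
qed

definition triple_integrand3 :: "multi_index \<Rightarrow> multi_index \<Rightarrow> multi_index \<Rightarrow> R3 \<Rightarrow> R3 \<Rightarrow> real" where
  "triple_integrand3 a b c u v = hermite a v * hermite_fun3 b v * hermite_fun3 c (v - u)"

lemma triple_integrand3_eq_prod:
  "triple_integrand3 a b c u v = (\<Prod>i\<in>UNIV. triple_integrand (a $ i) (b $ i) (c $ i) (u $ i) (v $ i))"
  by (simp add: triple_integrand3_def hermite_eq_prod hermite_fun3_def triple_integrand_def prod.distrib)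

lemma triple_integrand3_bound:
  obtains C where "C \<ge> 0"
    "\<And>u v. \<bar>triple_integrand3 a b c u v\<bar> \<le> C * (exp (- (norm v)\<^sup>2 / 16) * exp (- (norm u)\<^sup>2 / 16))"
proof -
  have "\<exists>C\<ge>0. \<forall>z::R3 \<times> R3. \<bar>triple_integrand (a $ i) (b $ i) (c $ i) (fst z $ i) (snd z $ i)\<bar> \<le>
     C * (exp (- 1 / 16 * (snd z $ i)\<^sup>2) * exp (- 1 / 16 * (fst z $ i)\<^sup>2))" for i
    by (rule triple_integrand_bound[of "a $ i" "b $ i" "c $ i"]) auto
  from prod_abs_bound[of "\<lambda>i z. triple_integrand (a $ i) (b $ i) (c $ i) (fst z $ i) (snd z $ i)"
    "\<lambda>i z. exp (- 1 / 16 * (snd z $ i)\<^sup>2) * exp (- 1 / 16 * (fst z $ i)\<^sup>2)", OF this]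
  obtain C where C: "C \<ge> 0" "\<And>z. \<bar>triple_integrand3 a b c (fst z) (snd z)\<bar> \<le>
      C * (\<Prod>i\<in>UNIV. exp (- 1 / 16 * (snd z $ i)\<^sup>2) * exp (- 1 / 16 * (fst z $ i)\<^sup>2))"
    unfolding triple_integrand3_eq_prod by blast
  have e: "(\<Prod>i\<in>UNIV. exp (- 1 / 16 * (v $ i)\<^sup>2)) = exp (- (norm v)\<^sup>2 / 16)" for v :: R3
    unfolding exp_norm_vec[symmetric] by simp
  show ?thesis
  proof (rule that[OF C(1)])
    show "\<bar>triple_integrand3 a b c u v\<bar> \<le> C * (exp (- (norm v)\<^sup>2 / 16) * exp (- (norm u)\<^sup>2 / 16))" for u v
      using C(2)[of "(u, v)"] unfolding prod.distrib fst_conv snd_conv e .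
  qed
qed

text \<open>
  The function \<open>J\<close> of the introduction.
\<close>

definition triple_integral3 :: "multi_index \<Rightarrow> multi_index \<Rightarrow> multi_index \<Rightarrow> R3 \<Rightarrow> real" where
  "triple_integral3 a b c u = (\<integral>v. triple_integrand3 a b c u v \<partial>lborel)"

lemma triple_integral3_eq_prod:
  "triple_integral3 a b c u = (\<Prod>i\<in>UNIV. triple_integral (a $ i) (b $ i) (c $ i) (u $ i))"
  unfolding triple_integral3_def triple_integrand3_eq_prod triple_integral_def
  by (rule integral_prod_components) (rule integrable_triple_integrand)

text \<open>
  Only the factor of the coordinate \<open>s\<close> differs between the three integrals. For \<open>a $ s = 0\<close> the
  truncated index on the right is harmless because its coefficient is zero.
\<close>

lemma triple_integral3_by_parts:
  "triple_integral3 a (b + unit_index s) c u + triple_integral3 a b (c + unit_index s) u =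
   real (a $ s) * triple_integral3 (a - unit_index s) b c u"
proof -
  let ?J = "\<lambda>a b c i. triple_integral (a $ i) (b $ i) (c $ i) (u $ i)"
  have split: "triple_integral3 a b c u = ?J a b c s * (\<Prod>i\<in>UNIV - {s}. ?J a b c i)" for a b c
    unfolding triple_integral3_eq_prod by (rule prod.remove) auto
  have eq: "(\<Prod>i\<in>UNIV - {s}. ?J a (b + unit_index s) c i) = (\<Prod>i\<in>UNIV - {s}. ?J a b c i)"
    "(\<Prod>i\<in>UNIV - {s}. ?J a b (c + unit_index s) i) = (\<Prod>i\<in>UNIV - {s}. ?J a b c i)"
    "(\<Prod>i\<in>UNIV - {s}. ?J (a - unit_index s) b c i) = (\<Prod>i\<in>UNIV - {s}. ?J a b c i)"
    by (intro prod.cong; auto simp: axis_def)+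
  have "?J a (b + unit_index s) c s + ?J a b (c + unit_index s) s = real (a $ s) * ?J (a - unit_index s) b c s"
    using triple_integral_by_parts[of "a $ s" "b $ s" "c $ s" "u $ s"] by simp
  then show ?thesis unfolding split eq by (simp only: distrib_right[symmetric] mult.assoc)
qed

section \<open>The collision kernel and its convolutions\<close>

lemma integral_affine_euclidean:
  fixes f :: "'a::euclidean_space \<Rightarrow> real"
  assumes "c \<noteq> 0" and f: "integrable lborel f"
  shows integrable_affine_euclidean: "integrable lborel (\<lambda>x. f (t + c *\<^sub>R x))"
    and "(\<integral>x. f x \<partial>lborel) = \<bar>c\<bar> ^ DIM('a) * (\<integral>x. f (t + c *\<^sub>R x) \<partial>lborel)"
proof -
  have [measurable]: "f \<in> borel_measurable borel" using borel_measurable_integrable[OF f] by simp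
  have lb: "lborel = density (distr lborel borel (\<lambda>x::'a. t + c *\<^sub>R x)) (\<lambda>_. ennreal (\<bar>c\<bar> ^ DIM('a)))"
    using lborel_affine[OF assms(1), of t] by (simp add: ennreal_power)
  have "integrable (density (distr lborel borel (\<lambda>x::'a. t + c *\<^sub>R x)) (\<lambda>_. ennreal (\<bar>c\<bar> ^ DIM('a)))) f"
    using f lb by metis
  then show "integrable lborel (\<lambda>x. f (t + c *\<^sub>R x))"
    using assms(1) by (simp add: integrable_density integrable_distr_eq)
  show "(\<integral>x. f x \<partial>lborel) = \<bar>c\<bar> ^ DIM('a) * (\<integral>x. f (t + c *\<^sub>R x) \<partial>lborel)"
    by (subst lb, subst integral_density) (simp_all add: integral_distr)
qed

lemma integral_reflect_euclidean:
  fixes f :: "'a::euclidean_space \<Rightarrow> real"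
  assumes "integrable lborel f"
  shows integrable_reflect_euclidean: "integrable lborel (\<lambda>x. f (t - x))"
    and "(\<integral>x. f (t - x) \<partial>lborel) = (\<integral>x. f x \<partial>lborel)"
  using integral_affine_euclidean[OF _ assms, of "-1" t] by simp_all

text \<open>
  By the mean value theorem, a bound of the derivative near \<open>0\<close> also bounds the difference quotients, so
  dominated convergence applies along every sequence tending to \<open>0\<close>.
\<close>

lemma has_derivative_integral_dominated:
  fixes f :: "real \<Rightarrow> 'a \<Rightarrow> real"
  assumes D: "\<And>u h. \<bar>h\<bar> < 1 \<Longrightarrow> ((\<lambda>h. f h u) has_real_derivative f' h u) (at h)"
    and int: "\<And>h. integrable M (f h)"
    and bound: "\<And>u h. \<bar>h\<bar> < 1 \<Longrightarrow> \<bar>f' h u\<bar> \<le> w u"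
    and w: "integrable M w"
    and meas: "f' 0 \<in> borel_measurable M"
  shows "((\<lambda>h. \<integral>u. f h u \<partial>M) has_real_derivative (\<integral>u. f' 0 u \<partial>M)) (at 0)"
proof -
  have lim: "((\<lambda>h. ((\<integral>u. f h u \<partial>M) - (\<integral>u. f 0 u \<partial>M)) / (h - 0)) \<longlongrightarrow> (\<integral>u. f' 0 u \<partial>M)) (at 0 within {-1<..<1})"
    unfolding tendsto_at_iff_sequentially
  proof (intro allI impI)
    fix X :: "nat \<Rightarrow> real"
    assume X: "\<forall>i. X i \<in> {-1<..<1} - {0}" and X0: "X \<longlonglongrightarrow> 0"
    have lt: "\<bar>X n\<bar> < 1" and nz: "X n \<noteq> 0" for n using X[rule_format, of n] by auto
    have "(\<lambda>n. \<integral>u. (f (X n) u - f 0 u) / X n \<partial>M) \<longlonglongrightarrow> (\<integral>u. f' 0 u \<partial>M)"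
    proof (rule integral_dominated_convergence[where w = w])
      show "AE u in M. (\<lambda>n. (f (X n) u - f 0 u) / X n) \<longlonglongrightarrow> f' 0 u"
      proof (intro always_eventually allI)
        fix u
        have "((\<lambda>h. (f h u - f 0 u) / (h - 0)) \<longlongrightarrow> f' 0 u) (at 0)"
          using D[of 0 u] unfolding has_field_derivative_iff by simp
        then have "((\<lambda>h. (f h u - f 0 u) / (h - 0)) \<circ> X) \<longlonglongrightarrow> f' 0 u"
          unfolding tendsto_at_iff_sequentially using nz X0 by blast
        then show "(\<lambda>n. (f (X n) u - f 0 u) / X n) \<longlonglongrightarrow> f' 0 u" by (simp add: o_def)
      qed
      show "AE u in M. norm ((f (X n) u - f 0 u) / X n) \<le> w u" for n
      proof (intro always_eventually allI)
        fix u
        have "norm (f (X n) u - f 0 u) \<le> w u * norm (X n - 0)"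
          by (rule field_differentiable_bound[of "{-1<..<1}" "\<lambda>h. f h u" "\<lambda>h. f' h u"])
            (use lt[of n] bound in \<open>auto intro!: has_field_derivative_at_within D\<close>)
        then show "norm ((f (X n) u - f 0 u) / X n) \<le> w u"
          using nz[of n] by (simp add: divide_le_eq)
      qed
    qed (use int w meas in \<open>auto intro!: borel_measurable_integrable\<close>)
    then show "((\<lambda>h. ((\<integral>u. f h u \<partial>M) - (\<integral>u. f 0 u \<partial>M)) / (h - 0)) \<circ> X) \<longlonglongrightarrow> (\<integral>u. f' 0 u \<partial>M)"
      by (simp add: o_def int)
  qed
  then show ?thesis
    unfolding has_field_derivative_iff by (subst (asm) at_within_open) auto
qed

lemma integrable_pair_times:
  fixes f :: "'a::euclidean_space \<Rightarrow> real" and g :: "'b::euclidean_space \<Rightarrow> real"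
  assumes f: "integrable lborel f" and g: "integrable lborel g"
  shows "integrable (lborel \<Otimes>\<^sub>M lborel) (\<lambda>z. f (fst z) * g (snd z))"
proof (rule lborel_pair.Fubini_integrable)
  have [measurable]: "f \<in> borel_measurable borel" "g \<in> borel_measurable borel"
    using borel_measurable_integrable[OF f] borel_measurable_integrable[OF g] by simp_all
  show "(\<lambda>z. f (fst z) * g (snd z)) \<in> borel_measurable (lborel \<Otimes>\<^sub>M lborel)" by measurable
  show "integrable lborel (\<lambda>x. \<integral>y. norm (f (fst (x, y)) * g (snd (x, y))) \<partial>lborel)"
    using f by (simp add: abs_mult)
  show "AE x in lborel. integrable lborel (\<lambda>y. f (fst (x, y)) * g (snd (x, y)))"
    using g by simp
qed

text \<open>
  Decay in \<open>v - u\<close> is decay in \<open>u\<close>, locally uniformly in \<open>v\<close>.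
\<close>

lemma exp_norm_shift_le:
  "exp (- (norm (v - u))\<^sup>2 / 4) \<le> exp ((norm v)\<^sup>2 / 4) * exp (- (norm u)\<^sup>2 / 8)" for u v :: R3
proof -
  have "(norm u)\<^sup>2 \<le> (norm (v - u) + norm v)\<^sup>2"
    by (intro power_mono) (metis norm_triangle_sub norm_minus_commute add.commute, simp)
  also have "\<dots> \<le> 2 * (norm (v - u))\<^sup>2 + 2 * (norm v)\<^sup>2"
    using zero_le_power2[of "norm (v - u) - norm v"] by (simp add: power2_sum power2_diff)
  finally show ?thesis by (simp flip: exp_add)
qed

locale landau =
  fixes \<Lambda> \<gamma> :: real
  assumes \<Lambda>_pos: "\<Lambda> > 0" and \<gamma>_gt: "\<gamma> > - 5"
begin

definition kern :: "3 \<Rightarrow> 3 \<Rightarrow> R3 \<Rightarrow> real" where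
  "kern s t u = landau_kernel \<Lambda> \<gamma> u $ s $ t"

lemma kern_eq:
  "kern s t u = \<Lambda> * norm u powr (\<gamma> + 2) * ((if s = t then 1 else 0) - u $ s * u $ t / (norm u)\<^sup>2)"
  by (simp add: kern_def landau_kernel_def proj_matrix_def)

lemma borel_measurable_kern [measurable]: "kern s t \<in> borel_measurable borel"
  unfolding kern_eq[abs_def] by measurable

lemma kern_bound: "\<bar>kern s t u\<bar> \<le> 2 * \<Lambda> * norm u powr (\<gamma> + 2)"
proof -
  have "\<bar>u $ s\<bar> * \<bar>u $ t\<bar> \<le> norm u * norm u"
    by (intro mult_mono component_le_norm_cart) auto
  then have "\<bar>u $ s * u $ t / (norm u)\<^sup>2\<bar> \<le> 1"
    by (cases "u = 0") (simp_all add: abs_mult power2_eq_square divide_le_eq)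
  moreover have "\<bar>x\<bar> \<le> 1 \<Longrightarrow> \<bar>(if s = t then 1 else 0) - x\<bar> \<le> 2" for x :: real by auto
  ultimately have "\<bar>(if s = t then 1 else 0) - u $ s * u $ t / (norm u)\<^sup>2\<bar> \<le> 2" by blast
  then have "\<Lambda> * norm u powr (\<gamma> + 2) * \<bar>(if s = t then 1 else 0) - u $ s * u $ t / (norm u)\<^sup>2\<bar> \<le> \<Lambda> * norm u powr (\<gamma> + 2) * 2"
    using \<Lambda>_pos by (intro mult_left_mono) auto
  then show ?thesis unfolding kern_eq abs_mult using \<Lambda>_pos by (simp add: mult_ac)
qed

text \<open>
  The assumption on \<open>\<gamma>\<close> enters here: the exponent \<open>\<gamma> + 2\<close> exceeds \<open>- 3\<close>.
\<close>

lemma integrable_kern_times: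
  assumes [measurable]: "f \<in> borel_measurable borel" and f: "\<And>u. \<bar>f u\<bar> \<le> C * exp (- c * (norm u)\<^sup>2)" and "c > 0"
  shows "integrable lborel (\<lambda>u. kern s t u * f u)"
proof (rule Bochner_Integration.integrable_bound)
  show "integrable lborel (\<lambda>u::R3. (2 * \<Lambda> * C) * (norm u powr (\<gamma> + 2) * exp (- c * (norm u)\<^sup>2)))"
    by (rule integrable_mult_right, rule integrable_norm_powr_gaussian) (use \<gamma>_gt \<open>c > 0\<close> in auto)
  have "norm (kern s t u * f u) \<le> norm ((2 * \<Lambda> * C) * (norm u powr (\<gamma> + 2) * exp (- c * (norm u)\<^sup>2)))" for u
  proof -
    have "norm (kern s t u * f u) \<le> (2 * \<Lambda> * norm u powr (\<gamma> + 2)) * (C * exp (- c * (norm u)\<^sup>2))"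
      unfolding real_norm_def abs_mult by (intro mult_mono kern_bound f) (use \<Lambda>_pos in auto)
    also have "\<dots> = (2 * \<Lambda> * C) * (norm u powr (\<gamma> + 2) * exp (- c * (norm u)\<^sup>2))" by simp
    finally show ?thesis by simp
  qed
  then show "AE u in lborel. norm (kern s t u * f u) \<le> norm ((2 * \<Lambda> * C) * (norm u powr (\<gamma> + 2) * exp (- c * (norm u)\<^sup>2)))"
    by (intro always_eventually allI)
qed simp

text \<open>
  The shift is put on the Hermite function, since that is the smooth factor.
\<close>

definition conv :: "3 \<Rightarrow> 3 \<Rightarrow> multi_index \<Rightarrow> R3 \<Rightarrow> real" where
  "conv s t b v = (\<integral>u. kern s t u * hermite_fun3 b (v - u) \<partial>lborel)"

lemma hermite_fun3_shift_bound:
  obtains C where "C \<ge> 0"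
    "\<And>v u. \<bar>hermite_fun3 b (v - u)\<bar> \<le> C * exp ((norm v)\<^sup>2 / 4) * exp (- (1 / 8) * (norm u)\<^sup>2)"
proof -
  obtain C where C: "C \<ge> 0" "\<And>v. \<bar>hermite_fun3 b v\<bar> \<le> C * exp (- (norm v)\<^sup>2 / 4)"
    by (rule hermite_fun3_bound[of b]) blast
  show ?thesis
  proof (rule that[OF C(1)])
    fix v u
    have "\<bar>hermite_fun3 b (v - u)\<bar> \<le> C * exp (- (norm (v - u))\<^sup>2 / 4)" by (rule C)
    also have "\<dots> \<le> C * (exp ((norm v)\<^sup>2 / 4) * exp (- (norm u)\<^sup>2 / 8))"
      by (intro mult_left_mono exp_norm_shift_le C)
    finally show "\<bar>hermite_fun3 b (v - u)\<bar> \<le> C * exp ((norm v)\<^sup>2 / 4) * exp (- (1 / 8) * (norm u)\<^sup>2)" by simp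
  qed
qed

lemma integrable_conv: "integrable lborel (\<lambda>u. kern s t u * hermite_fun3 b (v - u))"
proof -
  obtain C where C: "C \<ge> 0"
    "\<And>v u. \<bar>hermite_fun3 b (v - u)\<bar> \<le> C * exp ((norm v)\<^sup>2 / 4) * exp (- (1 / 8) * (norm u)\<^sup>2)"
    by (rule hermite_fun3_shift_bound[of b]) blast
  show ?thesis
    by (rule integrable_kern_times[of _ "C * exp ((norm v)\<^sup>2 / 4)" "1 / 8"]) (use C in simp_all)
qed

text \<open>
  The dominating function uses \<open>\<bar>v + h e\<^sub>i\<bar> \<le> \<bar>v\<bar> + 1\<close> to make the bound on the shifted Hermite function
  independent of \<open>h\<close>.
\<close>

lemma conv_has_derivative:
  "((\<lambda>h. conv s t b (v + h *\<^sub>R axis i 1)) has_real_derivative - conv s t (b + unit_index i) v) (at 0)"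
proof -
  let ?b = "b + unit_index i"
  obtain C where C: "C \<ge> 0"
    "\<And>v u. \<bar>hermite_fun3 ?b (v - u)\<bar> \<le> C * exp ((norm v)\<^sup>2 / 4) * exp (- (1 / 8) * (norm u)\<^sup>2)"
    by (rule hermite_fun3_shift_bound[of ?b]) blast
  define K where "K = C * exp ((norm v + 1)\<^sup>2 / 4)"
  define f' where "f' h u = kern s t u * - hermite_fun3 ?b (v + h *\<^sub>R axis i 1 - u)" for h u
  have b: "\<bar>hermite_fun3 ?b (v + h *\<^sub>R axis i 1 - u)\<bar> \<le> K * exp (- (1 / 8) * (norm u)\<^sup>2)" if "\<bar>h\<bar> < 1" for h u
  proof -
    have "norm (v + h *\<^sub>R axis i 1) \<le> norm v + 1"
      using norm_triangle_ineq[of v "h *\<^sub>R axis i 1"] that by (simp add: norm_axis_1)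
    then have "(norm (v + h *\<^sub>R axis i 1))\<^sup>2 \<le> (norm v + 1)\<^sup>2" by (intro power_mono) auto
    then have "C * exp ((norm (v + h *\<^sub>R axis i 1))\<^sup>2 / 4) * exp (- (1 / 8) * (norm u)\<^sup>2) \<le> K * exp (- (1 / 8) * (norm u)\<^sup>2)"
      unfolding K_def using C(1) by (intro mult_right_mono mult_left_mono) auto
    with C(2)[of "v + h *\<^sub>R axis i 1" u] show ?thesis by linarith
  qed
  have "((\<lambda>h. \<integral>u. kern s t u * hermite_fun3 b (v + h *\<^sub>R axis i 1 - u) \<partial>lborel) has_real_derivative
      (\<integral>u. f' 0 u \<partial>lborel)) (at 0)"
  proof (rule has_derivative_integral_dominated[where w = "\<lambda>u. \<bar>kern s t u * (K * exp (- (1 / 8) * (norm u)\<^sup>2))\<bar>"])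
    fix h :: real and u :: R3
    have "((\<lambda>h. hermite_fun3 b ((v - u) + h *\<^sub>R axis i 1)) has_real_derivative
       - hermite_fun3 ?b ((v - u) + h *\<^sub>R axis i 1)) (at h)" by (rule hermite_fun3_has_derivative)
    from DERIV_cmult[OF this, of "kern s t u"]
    show "((\<lambda>h. kern s t u * hermite_fun3 b (v + h *\<^sub>R axis i 1 - u)) has_real_derivative f' h u) (at h)"
      by (simp add: f'_def algebra_simps)
    show "\<bar>f' h u\<bar> \<le> \<bar>kern s t u * (K * exp (- (1 / 8) * (norm u)\<^sup>2))\<bar>" if "\<bar>h\<bar> < 1"
      unfolding f'_def abs_mult abs_minus_cancel[of "hermite_fun3 _ _"]
      using order.trans[OF b[OF that, of u] abs_ge_self] by (intro mult_left_mono) (simp_all add: abs_mult)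
  next
    show "integrable lborel (\<lambda>u. kern s t u * hermite_fun3 b (v + h *\<^sub>R axis i 1 - u))" for h
      by (rule integrable_conv)
    show "integrable lborel (\<lambda>u. \<bar>kern s t u * (K * exp (- (1 / 8) * (norm u)\<^sup>2))\<bar>)"
      by (intro integrable_abs integrable_kern_times[of _ K "1/8"])
        (use C(1) in \<open>simp_all add: K_def\<close>)
    show "f' 0 \<in> borel_measurable lborel" unfolding f'_def by measurable
  qed
  then show ?thesis by (simp add: conv_def f'_def)
qed

section \<open>The weak form of the collision operator\<close>

definition kern_moment :: "3 \<Rightarrow> 3 \<Rightarrow> multi_index \<Rightarrow> multi_index \<Rightarrow> multi_index \<Rightarrow> real" where
  "kern_moment s t a b c = (\<integral>u. kern s t u * triple_integral3 a b c u \<partial>lborel)"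

text \<open>
  The joint decay of the smooth factor separates the variables: a Gaussian in \<open>v\<close> times an integrable
  function of \<open>u\<close> that contains the singular kernel.
\<close>

lemma integrable_kern_triple_integrand3:
  "integrable (lborel \<Otimes>\<^sub>M lborel) (\<lambda>(v, u). kern s t u * triple_integrand3 a b c u v)"
proof -
  obtain C where C: "C \<ge> 0"
    "\<And>u v. \<bar>triple_integrand3 a b c u v\<bar> \<le> C * (exp (- (norm v)\<^sup>2 / 16) * exp (- (norm u)\<^sup>2 / 16))"
    by (rule triple_integrand3_bound[of a b c]) blast
  define A where "A v = C * exp (- (1 / 16) * (norm v)\<^sup>2)" for v :: R3
  define B where "B u = kern s t u * exp (- (1 / 16) * (norm u)\<^sup>2)" for u :: R3
  have "integrable lborel (\<lambda>v::R3. \<Prod>i\<in>UNIV. exp (- (1 / 16) * (v $ i)\<^sup>2))"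
    by (rule integrable_prod_components, rule integrable_exp_square) simp
  then have A: "integrable lborel A"
    unfolding A_def exp_norm_vec by (rule integrable_mult_right)
  have B: "integrable lborel B"
    unfolding B_def by (rule integrable_kern_times[of _ 1 "1/16"]) simp_all
  have [measurable]: "(\<lambda>z. triple_integrand3 a b c (snd z) (fst z)) \<in> borel_measurable (borel \<Otimes>\<^sub>M borel)"
    unfolding triple_integrand3_def by measurable
  show ?thesis
  proof (rule Bochner_Integration.integrable_bound[OF integrable_pair_times[OF A B]])
    show "(\<lambda>(v, u). kern s t u * triple_integrand3 a b c u v) \<in> borel_measurable (lborel \<Otimes>\<^sub>M lborel)"
      unfolding case_prod_unfold by measurable
    have "norm (kern s t u * triple_integrand3 a b c u v) \<le> norm (A v * B u)" for u v
    proof -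
      have "norm (kern s t u * triple_integrand3 a b c u v) \<le> \<bar>kern s t u\<bar> * (C * (exp (- (norm v)\<^sup>2 / 16) * exp (- (norm u)\<^sup>2 / 16)))"
        unfolding real_norm_def abs_mult by (intro mult_left_mono C) simp
      also have "\<dots> = norm (A v * B u)" using C(1) by (simp add: A_def B_def abs_mult)
      finally show ?thesis .
    qed
    then show "AE z in lborel \<Otimes>\<^sub>M lborel. norm (case z of (v, u) \<Rightarrow> kern s t u * triple_integrand3 a b c u v) \<le> norm (A (fst z) * B (snd z))"
      by (intro always_eventually allI) (simp add: case_prod_unfold)
  qed
qed

lemma kern_inner_integral:
  "(\<integral>u. kern s t u * triple_integrand3 a b c u v \<partial>lborel) = hermite a v * (hermite_fun3 b v * conv s t c v)"
proof -
  have "(\<integral>u. kern s t u * triple_integrand3 a b c u v \<partial>lborel) =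
      (\<integral>u. (hermite a v * hermite_fun3 b v) * (kern s t u * hermite_fun3 c (v - u)) \<partial>lborel)"
    unfolding triple_integrand3_def by (intro Bochner_Integration.integral_cong refl) (simp only: mult_ac)
  also have "\<dots> = (hermite a v * hermite_fun3 b v) * conv s t c v"
    unfolding conv_def by (rule integral_mult_right_zero)
  finally show ?thesis by simp
qed

lemma integrable_hermite_conv: "integrable lborel (\<lambda>v. hermite a v * (hermite_fun3 b v * conv s t c v))"
  using lborel_pair.integrable_fst[OF integrable_kern_triple_integrand3[of s t a b c]]
  by (simp add: kern_inner_integral)

lemma integrable_kern_triple_integral3: "integrable lborel (\<lambda>u. kern s t u * triple_integral3 a b c u)"
  using lborel_pair.integrable_snd[OF integrable_kern_triple_integrand3[of s t a b c]]
  by (simp add: triple_integral3_def)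

text \<open>
  Fubini: the weak form with \<open>v\<close> outside equals the one with the kernel variable \<open>u\<close> outside.
\<close>

lemma integral_hermite_conv:
  "(\<integral>v. hermite a v * (hermite_fun3 b v * conv s t c v) \<partial>lborel) = kern_moment s t a b c"
  using lborel_pair.Fubini_integral[OF integrable_kern_triple_integrand3[of s t a b c]]
  by (simp add: kern_inner_integral kern_moment_def triple_integral3_def)

lemma kern_moment_by_parts:
  "kern_moment s t a (b + unit_index i) c + kern_moment s t a b (c + unit_index i) =
   real (a $ i) * kern_moment s t (a - unit_index i) b c"
proof -
  have "kern_moment s t a (b + unit_index i) c + kern_moment s t a b (c + unit_index i) =
     (\<integral>u. kern s t u * triple_integral3 a (b + unit_index i) c u + kern s t u * triple_integral3 a b (c + unit_index i) u \<partial>lborel)"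
    unfolding kern_moment_def by (intro Bochner_Integration.integral_add[symmetric] integrable_kern_triple_integral3)
  also have "\<dots> = (\<integral>u. real (a $ i) * (kern s t u * triple_integral3 (a - unit_index i) b c u) \<partial>lborel)"
    unfolding distrib_left[symmetric] triple_integral3_by_parts by (simp only: mult.left_commute)
  also have "\<dots> = real (a $ i) * kern_moment s t (a - unit_index i) b c"
    unfolding kern_moment_def by (rule integral_mult_right_zero)
  finally show ?thesis .
qed

text \<open>
  The substitution \<open>w = v - u\<close> turns the integral over \<open>w\<close> into convolutions; the sign of the gradient of
  a Hermite function exchanges the two terms.
\<close>

lemma collision_flux_eq:
  "(\<integral>w. landau_kernel \<Lambda> \<gamma> (v - w) *v (hermite_fun3 l w *\<^sub>R grad (hermite_fun3 k) v - hermite_fun3 l v *\<^sub>R grad (hermite_fun3 k) w) \<partial>lborel) $ s =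
   (\<Sum>t\<in>UNIV. hermite_fun3 l v * conv s t (k + unit_index t) v - hermite_fun3 (k + unit_index t) v * conv s t l v)"
proof -
  define G where "G w = landau_kernel \<Lambda> \<gamma> (v - w) *v (hermite_fun3 l w *\<^sub>R grad (hermite_fun3 k) v - hermite_fun3 l v *\<^sub>R grad (hermite_fun3 k) w)" for w
  have shift: "integrable lborel (\<lambda>w. kern s t (v - w) * hermite_fun3 b w)"
    "(\<integral>w. kern s t (v - w) * hermite_fun3 b w \<partial>lborel) = conv s t b v" for s t b
    using integral_reflect_euclidean[OF integrable_conv[of s t b v], of v] by (simp_all add: conv_def)
  have G: "G w $ s = (\<Sum>t\<in>UNIV. hermite_fun3 l v * (kern s t (v - w) * hermite_fun3 (k + unit_index t) w)
      - hermite_fun3 (k + unit_index t) v * (kern s t (v - w) * hermite_fun3 l w))" for w s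
    unfolding G_def matrix_vector_mult_def grad_hermite_fun3
    by (simp add: kern_def algebra_simps)
  have int: "integrable lborel (\<lambda>w. G w $ s)" for s
    unfolding G by (intro Bochner_Integration.integrable_sum Bochner_Integration.integrable_diff integrable_mult_right shift)
  have "integrable lborel (\<lambda>w. \<Sum>s\<in>UNIV. (G w $ s) *\<^sub>R axis s (1::real))"
    by (intro Bochner_Integration.integrable_sum integrable_scaleR_left int)
  moreover have "(\<Sum>s\<in>UNIV. (G w $ s) *\<^sub>R axis s (1::real)) = G w" for w
    using basis_expansion[of "G w"] by (simp add: scalar_mult_eq_scaleR)
  \<comment> \<open>Components commute with the vector-valued integral only once the vector is known to be integrable.\<close>
  ultimately have "integrable lborel G" by simp
  from integral_bounded_linear[OF bounded_linear_vec_nth this, of s]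
  have "(\<integral>w. G w \<partial>lborel) $ s = (\<integral>w. G w $ s \<partial>lborel)" by simp
  also have "\<dots> = (\<Sum>t\<in>UNIV. hermite_fun3 l v * conv s t (k + unit_index t) v - hermite_fun3 (k + unit_index t) v * conv s t l v)"
    unfolding G by (simp add: shift)
  finally show ?thesis unfolding G_def .
qed

lemma hermite_fun3_conv_has_derivative:
  "((\<lambda>h. hermite_fun3 a (v + h *\<^sub>R axis i 1) * conv s t b (v + h *\<^sub>R axis i 1)) has_real_derivative
    - (hermite_fun3 (a + unit_index i) v * conv s t b v + hermite_fun3 a v * conv s t (b + unit_index i) v)) (at 0)"
  using DERIV_mult[OF hermite_fun3_has_derivative[of a v i 0] conv_has_derivative[of s t b v i]]
  by (simp add: algebra_simps)

text \<open>
  The product rule gives two terms for each product in the flux, paired so that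
  \<open>kern_moment_by_parts\<close> applies to each pair.
\<close>

lemma landau_bilinear_eq:
  "landau_bilinear \<Lambda> \<gamma> (hermite_fun3 l) (hermite_fun3 k) v =
   (\<Sum>s\<in>UNIV. \<Sum>t\<in>UNIV.
     (hermite_fun3 (k + unit_index t + unit_index s) v * conv s t l v + hermite_fun3 (k + unit_index t) v * conv s t (l + unit_index s) v)
     - (hermite_fun3 (l + unit_index s) v * conv s t (k + unit_index t) v + hermite_fun3 l v * conv s t (k + unit_index t + unit_index s) v))"
  unfolding landau_bilinear_def divergence_def collision_flux_eq partial_deriv_def
proof (intro sum.cong refl DERIV_imp_deriv)
  fix s :: 3
  show "((\<lambda>h. \<Sum>t\<in>UNIV. hermite_fun3 l (v + h *\<^sub>R axis s 1) * conv s t (k + unit_index t) (v + h *\<^sub>R axis s 1) -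
      hermite_fun3 (k + unit_index t) (v + h *\<^sub>R axis s 1) * conv s t l (v + h *\<^sub>R axis s 1)) has_real_derivative
    (\<Sum>t\<in>UNIV. (hermite_fun3 (k + unit_index t + unit_index s) v * conv s t l v + hermite_fun3 (k + unit_index t) v * conv s t (l + unit_index s) v)
     - (hermite_fun3 (l + unit_index s) v * conv s t (k + unit_index t) v + hermite_fun3 l v * conv s t (k + unit_index t + unit_index s) v))) (at 0)"
    by (rule DERIV_sum, rule DERIV_cong[OF DERIV_diff[OF hermite_fun3_conv_has_derivative hermite_fun3_conv_has_derivative]]) simp
qed

text \<open>
  Each application of \<open>kern_moment_by_parts\<close> exchanges the derivative along \<open>e\<^sub>s\<close> for the factor
  \<open>\<alpha> $ s\<close> and the polynomial of order \<open>\<alpha> - e\<^sub>s\<close>.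
\<close>

lemma landau_coeff_eq_kern_moment:
  "landau_coeff \<Lambda> \<gamma> \<alpha> l k = 1 / mi_fact \<alpha> * (\<Sum>s\<in>UNIV. \<Sum>t\<in>UNIV. real (\<alpha> $ s) *
     (kern_moment s t (\<alpha> - unit_index s) (k + unit_index t) l - kern_moment s t (\<alpha> - unit_index s) l (k + unit_index t)))"
proof -
  let ?T = "\<lambda>s t a b v. hermite \<alpha> v * (hermite_fun3 a v * conv s t b v)"
  have f: "(\<lambda>u. hermite b u * maxwellian u) = hermite_fun3 b" for b
    by (simp add: hermite_times_maxwellian fun_eq_iff)
  have "(\<integral>v. hermite \<alpha> v * landau_bilinear \<Lambda> \<gamma> (hermite_fun3 l) (hermite_fun3 k) v \<partial>lborel) =
     (\<integral>v. (\<Sum>s\<in>UNIV. \<Sum>t\<in>UNIV.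
       (?T s t (k + unit_index t + unit_index s) l v + ?T s t (k + unit_index t) (l + unit_index s) v)
       - (?T s t (l + unit_index s) (k + unit_index t) v + ?T s t l (k + unit_index t + unit_index s) v)) \<partial>lborel)"
    unfolding landau_bilinear_eq by (intro Bochner_Integration.integral_cong refl) (simp only: sum_distrib_left distrib_left right_diff_distrib)
  also have "\<dots> = (\<Sum>s\<in>UNIV. \<Sum>t\<in>UNIV.
       (kern_moment s t \<alpha> (k + unit_index t + unit_index s) l + kern_moment s t \<alpha> (k + unit_index t) (l + unit_index s))
       - (kern_moment s t \<alpha> (l + unit_index s) (k + unit_index t) + kern_moment s t \<alpha> l (k + unit_index t + unit_index s)))"
    by (simp add: integrable_hermite_conv integral_hermite_conv)
  also have "\<dots> = (\<Sum>s\<in>UNIV. \<Sum>t\<in>UNIV. real (\<alpha> $ s) *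
     (kern_moment s t (\<alpha> - unit_index s) (k + unit_index t) l - kern_moment s t (\<alpha> - unit_index s) l (k + unit_index t)))"
    unfolding kern_moment_by_parts right_diff_distrib ..
  finally show ?thesis unfolding landau_coeff_def f by simp
qed

end

section \<open>Rotation to mean and relative velocity\<close>

lemma prod_sum_multi_index:
  fixes F :: "'n::finite \<Rightarrow> nat \<Rightarrow> 'a::comm_semiring_1" and m :: "nat ^ 'n"
  shows "(\<Prod>i\<in>UNIV. \<Sum>p\<le>m $ i. F i p) = (\<Sum>p | p \<le> m. \<Prod>i\<in>UNIV. F i (p $ i))"
proof -
  have "(\<Prod>i\<in>UNIV. \<Sum>p\<le>m $ i. F i p) = (\<Sum>g\<in>PiE UNIV (\<lambda>i. {..m $ i}). \<Prod>i\<in>UNIV. F i (g i))"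
    by (rule prod_sum_PiE) auto
  also have "\<dots> = (\<Sum>p | p \<le> m. \<Prod>i\<in>UNIV. F i (p $ i))"
    by (rule sum.reindex_bij_witness[where i = vec_nth and j = vec_lambda])
      (auto simp: less_eq_vec_def vec_lambda_inverse vec_nth_inverse PiE_def Pi_def)
  finally show ?thesis .
qed

lemma prod_powr_half:
  "(\<Prod>i\<in>UNIV. 2 powr (- real (Suc (a $ i)) / 2)) = 2 powr (- real (mi_abs a + 3) / 2)" for a :: multi_index
proof -
  have "(\<Prod>i\<in>UNIV. 2 powr (- real (Suc (a $ i)) / 2)) = 2 powr (\<Sum>i\<in>UNIV. - real (Suc (a $ i)) / 2)"
    by (rule powr_sum[symmetric]) auto
  also have "(\<Sum>i\<in>UNIV. - real (Suc (a $ i)) / 2) = - real (mi_abs a + 3) / 2"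
    by (simp add: mi_abs_def sum_3 field_simps)
  finally show ?thesis .
qed

text \<open>
  The coordinates \<open>p\<^sub>i \<le> min a\<^sub>i (b\<^sub>i + c\<^sub>i)\<close> of the one-dimensional sums combine to a multi-index.
\<close>

lemma triple_integral3_rotate:
  "triple_integral3 a b c (sqrt 2 *\<^sub>R g) = 2 powr (- real (mi_abs a + 3) / 2) *
     (\<Sum>p | p \<le> a \<and> p \<le> b + c. mi_fact a / mi_fact (a - p) * a3 b c p (b + c - p) *
        (hermite (a - p) g * hermite (b + c - p) g * maxwellian g))"
proof -
  define m :: multi_index where "m = (\<chi> i. min (a $ i) (b $ i + c $ i))"
  have "triple_integral3 a b c (sqrt 2 *\<^sub>R g) = (\<Prod>i\<in>UNIV. 2 powr (- real (Suc (a $ i)) / 2)) *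
     (\<Prod>i\<in>UNIV. \<Sum>p\<le>m $ i. fact (a $ i) / fact (a $ i - p) * a1 (b $ i) (c $ i) p (b $ i + c $ i - p) *
       (poly (he (a $ i - p)) (g $ i) * poly (he (b $ i + c $ i - p)) (g $ i) * gauss (g $ i)))"
    unfolding triple_integral3_eq_prod prod.distrib[symmetric] by (simp add: triple_integral_rotate m_def)
  also have "{p. p \<le> m} = {p. p \<le> a \<and> p \<le> b + c}"
    by (auto simp: less_eq_vec_def m_def)
  then have "(\<Prod>i\<in>UNIV. \<Sum>p\<le>m $ i. fact (a $ i) / fact (a $ i - p) * a1 (b $ i) (c $ i) p (b $ i + c $ i - p) *
       (poly (he (a $ i - p)) (g $ i) * poly (he (b $ i + c $ i - p)) (g $ i) * gauss (g $ i))) =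
     (\<Sum>p | p \<le> a \<and> p \<le> b + c. mi_fact a / mi_fact (a - p) * a3 b c p (b + c - p) *
        (hermite (a - p) g * hermite (b + c - p) g * maxwellian g))"
    unfolding prod_sum_multi_index
    by (simp add: mi_fact_def a3_def hermite_eq_prod maxwellian_eq_prod prod.distrib prod_dividef)
  finally show ?thesis unfolding prod_powr_half .
qed

context landau
begin

text \<open>
  The weights of the integrals in \<open>B_coeff\<close> appear. At \<open>g = 0\<close> both sides vanish, the left one because
  \<open>0 powr a = 0\<close>.
\<close>

lemma kern_scaled:
  "kern s t (sqrt 2 *\<^sub>R g) = \<Lambda> * 2 powr ((\<gamma> + 2) / 2) *
     (norm g powr \<gamma> * ((if s = t then \<Sum>r\<in>UNIV. g $ r * g $ r else 0) - g $ s * g $ t))"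
proof (cases "g = 0")
  case True
  then show ?thesis by (simp add: kern_eq)
next
  case False
  have "sqrt 2 powr (\<gamma> + 2) = 2 powr ((\<gamma> + 2) / 2)"
    by (simp add: powr_half_sqrt[symmetric] powr_powr)
  then have 1: "norm (sqrt 2 *\<^sub>R g) powr (\<gamma> + 2) = 2 powr ((\<gamma> + 2) / 2) * norm g powr (\<gamma> + 2)"
    by (simp add: powr_mult)
  have 2: "norm g powr (\<gamma> + 2) = norm g powr \<gamma> * (norm g)\<^sup>2"
    using False by (simp add: powr_add)
  have 3: "(sqrt 2 *\<^sub>R g) $ s * (sqrt 2 *\<^sub>R g) $ t / (norm (sqrt 2 *\<^sub>R g))\<^sup>2 = g $ s * g $ t / (norm g)\<^sup>2"
    by (simp add: power_mult_distrib field_simps)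
  have 4: "(\<Sum>r\<in>UNIV. g $ r * g $ r) = (norm g)\<^sup>2"
    by (simp add: norm_vec_power2 power2_eq_square[symmetric])
  show ?thesis
    unfolding kern_eq 1 2 3 4 using False by (simp add: field_simps)
qed

text \<open>
  The two components of \<open>g\<close> raise the exponent of \<open>\<bar>g\<bar>\<close> from \<open>\<gamma>\<close> to \<open>\<gamma> + 2\<close>.
\<close>

lemma integrable_G_int:
  "integrable lborel (\<lambda>g. norm g powr \<gamma> * g $ s * g $ t * hermite p g * hermite q g * maxwellian g)"
proof -
  have "\<exists>C\<ge>0. \<forall>v::R3. \<bar>poly (he (p $ i)) (v $ i) * hermite_fun (q $ i) (v $ i)\<bar> \<le> C * exp (- (1 / 4) * (v $ i)\<^sup>2)" for i
    by (rule he_hermite_fun_bound[of "p $ i" "q $ i"]) auto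
  from prod_abs_bound[of "\<lambda>i v. poly (he (p $ i)) (v $ i) * hermite_fun (q $ i) (v $ i)" "\<lambda>i v. exp (- (1 / 4) * (v $ i)\<^sup>2)", OF this]
  obtain C where C: "C \<ge> 0" "\<And>v. \<bar>hermite p v * hermite q v * maxwellian v\<bar> \<le> C * exp (- (1 / 4) * (norm v)\<^sup>2)"
    unfolding mult.assoc[of "hermite _ _"] hermite_times_maxwellian
    unfolding hermite_eq_prod hermite_fun3_def prod.distrib[symmetric] exp_norm_vec by blast
  show ?thesis
  proof (rule Bochner_Integration.integrable_bound)
    show "integrable lborel (\<lambda>u::R3. C * (norm u powr (\<gamma> + 2) * exp (- (1 / 4) * (norm u)\<^sup>2)))"
      by (rule integrable_mult_right, rule integrable_norm_powr_gaussian) (use \<gamma>_gt in auto)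
    have "norm (norm g powr \<gamma> * g $ s * g $ t * hermite p g * hermite q g * maxwellian g) \<le>
        norm (C * (norm g powr (\<gamma> + 2) * exp (- (1 / 4) * (norm g)\<^sup>2)))" for g
    proof (cases "g = 0")
      case False
      have "\<bar>g $ s\<bar> * \<bar>g $ t\<bar> \<le> norm g * norm g" by (intro mult_mono component_le_norm_cart) auto
      then have "norm g powr \<gamma> * (\<bar>g $ s\<bar> * \<bar>g $ t\<bar>) \<le> norm g powr \<gamma> * (norm g * norm g)"
        by (intro mult_left_mono) auto
      also have "\<dots> = norm g powr (\<gamma> + 2)" using False by (simp add: powr_add power2_eq_square)
      finally have "(norm g powr \<gamma> * (\<bar>g $ s\<bar> * \<bar>g $ t\<bar>)) * \<bar>hermite p g * hermite q g * maxwellian g\<bar> \<le>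
         norm g powr (\<gamma> + 2) * (C * exp (- (1 / 4) * (norm g)\<^sup>2))"
        by (intro mult_mono C(2)) auto
      then show ?thesis using C(1) by (simp add: abs_mult mult_ac)
    qed simp
    then show "AE g in lborel. norm (norm g powr \<gamma> * g $ s * g $ t * hermite p g * hermite q g * maxwellian g) \<le>
        norm (C * (norm g powr (\<gamma> + 2) * exp (- (1 / 4) * (norm g)\<^sup>2)))"
      by (intro always_eventually allI)
  qed (unfold maxwellian_def, measurable)
qed

lemma integral_B_coeff:
  shows integrable_B_coeff: "integrable lborel (\<lambda>g. norm g powr \<gamma> * ((if s = t then \<Sum>r\<in>UNIV. g $ r * g $ r else 0) - g $ s * g $ t) *
      (hermite q g * hermite p g * maxwellian g))"
    and "(\<integral>g. norm g powr \<gamma> * ((if s = t then \<Sum>r\<in>UNIV. g $ r * g $ r else 0) - g $ s * g $ t) *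
      (hermite q g * hermite p g * maxwellian g) \<partial>lborel) = B_coeff \<gamma> s t p q"
proof -
  let ?g = "\<lambda>s t g. norm g powr \<gamma> * g $ s * g $ t * hermite p g * hermite q g * maxwellian g"
  have eq: "norm g powr \<gamma> * ((if s = t then \<Sum>r\<in>UNIV. g $ r * g $ r else 0) - g $ s * g $ t) *
      (hermite q g * hermite p g * maxwellian g) =
      - ?g s t g + (if s = t then 1 else 0) * (\<Sum>r\<in>UNIV. ?g r r g)" for g
    by (simp add: sum_3 algebra_simps)
  show "integrable lborel (\<lambda>g. norm g powr \<gamma> * ((if s = t then \<Sum>r\<in>UNIV. g $ r * g $ r else 0) - g $ s * g $ t) *
      (hermite q g * hermite p g * maxwellian g))"
    unfolding eq by (intro Bochner_Integration.integrable_add integrable_minus integrable_mult_right Bochner_Integration.integrable_sum integrable_G_int)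
  have "(\<integral>g. norm g powr \<gamma> * ((if s = t then \<Sum>r\<in>UNIV. g $ r * g $ r else 0) - g $ s * g $ t) *
      (hermite q g * hermite p g * maxwellian g) \<partial>lborel) =
     (\<integral>g. - ?g s t g \<partial>lborel) + (\<integral>g. (if s = t then 1 else 0) * (\<Sum>r\<in>UNIV. ?g r r g) \<partial>lborel)"
    unfolding eq by (intro Bochner_Integration.integral_add integrable_minus integrable_mult_right Bochner_Integration.integrable_sum integrable_G_int)
  also have "\<dots> = B_coeff \<gamma> s t p q"
    unfolding B_coeff_def G_int_def
    by (simp only: integral_minus integral_mult_right_zero Bochner_Integration.integral_sum[OF integrable_G_int])
  finally show "(\<integral>g. norm g powr \<gamma> * ((if s = t then \<Sum>r\<in>UNIV. g $ r * g $ r else 0) - g $ s * g $ t) *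
      (hermite q g * hermite p g * maxwellian g) \<partial>lborel) = B_coeff \<gamma> s t p q" .
qed

text \<open>
  After \<open>u = \<surd>2 g\<close>, the power of two collects \<open>3 / 2\<close> from the volume, \<open>(\<gamma> + 2) / 2\<close> from the kernel and
  \<open>- (\<bar>a\<bar> + 3) / 2\<close> from the rotation.
\<close>

lemma kern_moment_eq_sum:
  "kern_moment s t a b c = \<Lambda> * 2 powr ((\<gamma> + 2 - real (mi_abs a)) / 2) *
     (\<Sum>p | p \<le> a \<and> p \<le> b + c. mi_fact a / mi_fact (a - p) * a3 b c p (b + c - p) * B_coeff \<gamma> s t (b + c - p) (a - p))"
proof -
  let ?P = "{p. p \<le> a \<and> p \<le> b + c}"
  let ?w = "\<lambda>g::R3. norm g powr \<gamma> * ((if s = t then \<Sum>r\<in>UNIV. g $ r * g $ r else 0) - g $ s * g $ t)"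
  let ?c = "\<lambda>p. mi_fact a / mi_fact (a - p) * a3 b c p (b + c - p)"
  let ?h = "\<lambda>p g. hermite (a - p) g * hermite (b + c - p) g * maxwellian g"
  let ?K = "\<Lambda> * 2 powr ((\<gamma> + 2) / 2) * 2 powr (- real (mi_abs a + 3) / 2)"
  have "kern_moment s t a b c = \<bar>sqrt 2\<bar> ^ DIM(R3) * (\<integral>g. kern s t (0 + sqrt 2 *\<^sub>R g) * triple_integral3 a b c (0 + sqrt 2 *\<^sub>R g) \<partial>lborel)"
    unfolding kern_moment_def by (rule integral_affine_euclidean) (simp_all add: integrable_kern_triple_integral3)
  also have "(\<lambda>g. kern s t (0 + sqrt 2 *\<^sub>R g) * triple_integral3 a b c (0 + sqrt 2 *\<^sub>R g)) =
      (\<lambda>g. ?K * (\<Sum>p\<in>?P. ?c p * (?w g * ?h p g)))"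
    unfolding add_0 kern_scaled triple_integral3_rotate
    by (simp only: fun_eq_iff sum_distrib_left) (auto intro!: sum.cong simp only: mult_ac)
  also have "(\<integral>g. ?K * (\<Sum>p\<in>?P. ?c p * (?w g * ?h p g)) \<partial>lborel) = ?K * (\<Sum>p\<in>?P. ?c p * B_coeff \<gamma> s t (b + c - p) (a - p))"
    by (simp only: integral_mult_right_zero Bochner_Integration.integral_sum integrable_mult_right integrable_B_coeff integral_B_coeff)
  also have "\<bar>sqrt 2\<bar> ^ DIM(R3) * (?K * (\<Sum>p\<in>?P. ?c p * B_coeff \<gamma> s t (b + c - p) (a - p))) =
     \<Lambda> * (\<bar>sqrt 2\<bar> ^ DIM(R3) * 2 powr ((\<gamma> + 2) / 2) * 2 powr (- real (mi_abs a + 3) / 2)) * (\<Sum>p\<in>?P. ?c p * B_coeff \<gamma> s t (b + c - p) (a - p))"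
    by (simp only: mult_ac)
  also have "\<bar>sqrt 2\<bar> ^ DIM(R3) = 2 powr (3 / 2)"
    by (simp add: powr_half_sqrt[symmetric] powr_power)
  also have "2 powr (3 / 2) * 2 powr ((\<gamma> + 2) / 2) * 2 powr (- real (mi_abs a + 3) / 2) = 2 powr ((\<gamma> + 2 - real (mi_abs a)) / 2)"
    unfolding powr_add[symmetric] by (rule arg_cong) (simp add: field_simps)
  finally show ?thesis .
qed

end

section \<open>The coefficients\<close>

text \<open>
  For \<open>\<alpha> $ s \<noteq> 0\<close> the difference \<open>\<alpha> - e\<^sub>s\<close> is exact, and every \<open>p\<close> below it has smaller order than \<open>\<alpha>\<close>.
\<close>

lemma admissible_eq:
  assumes "\<alpha> $ s \<noteq> 0"
  shows "admissible \<alpha> l k s t = {p. p \<le> \<alpha> - unit_index s \<and> p \<le> l + k + unit_index t}"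
proof -
  have le: "p + unit_index s \<le> \<alpha> \<longleftrightarrow> p \<le> \<alpha> - unit_index s" for p
    using assms by (auto simp: less_eq_vec_def axis_def)
  have "mi_abs p < mi_abs \<alpha>" if "p + unit_index s \<le> \<alpha>" for p
  proof -
    have "mi_abs (p + unit_index s) \<le> mi_abs \<alpha>"
      using that unfolding mi_abs_def less_eq_vec_def by (intro sum_mono) auto
    moreover have "mi_abs (p + unit_index s) = mi_abs p + 1"
      by (simp add: mi_abs_def sum.distrib axis_def)
    ultimately show ?thesis by simp
  qed
  then show ?thesis unfolding admissible_def le[symmetric] by blast
qed

lemma mi_fact_pos: "mi_fact a > 0"
  unfolding mi_fact_def by (intro prod_pos) auto

lemma mi_fact_minus_unit:
  assumes "a $ s \<noteq> 0"
  shows "mi_fact a = real (a $ s) * mi_fact (a - unit_index s)"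
proof -
  have "mi_fact b = fact (b $ s) * (\<Prod>i\<in>UNIV - {s}. fact (b $ i))" for b
    unfolding mi_fact_def by (rule prod.remove) auto
  moreover have "(\<Prod>i\<in>UNIV - {s}. fact ((a - unit_index s) $ i)) = (\<Prod>i\<in>UNIV - {s}. fact (a $ i) :: real)"
    by (intro prod.cong) (auto simp: axis_def)
  moreover have "fact (a $ s) = real (a $ s) * fact (a $ s - 1)"
    using assms by (simp add: fact_reduce)
  ultimately show ?thesis by simp
qed

lemma mi_abs_minus_unit:
  assumes "a $ s \<noteq> 0"
  shows "real (mi_abs (a - unit_index s)) = real (mi_abs a) - 1"
proof -
  have "mi_abs b = b $ s + (\<Sum>i\<in>UNIV - {s}. b $ i)" for b
    unfolding mi_abs_def by (rule sum.remove) auto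
  moreover have "(\<Sum>i\<in>UNIV - {s}. (a - unit_index s) $ i) = (\<Sum>i\<in>UNIV - {s}. a $ i)"
    by (intro sum.cong) (auto simp: axis_def)
  ultimately show ?thesis using assms by simp
qed

theorem theorem1:
  fixes \<Lambda> \<gamma> :: real and \<alpha> lam \<kappa> :: multi_index
  assumes "\<Lambda> > 0" and "\<gamma> > - 5"
  shows "landau_coeff \<Lambda> \<gamma> \<alpha> lam \<kappa> =
    2 powr ((\<gamma> + 3 - real (mi_abs \<alpha>)) / 2) *
    (\<Sum>s\<in>UNIV. \<Sum>t\<in>UNIV. \<Sum>p\<in>admissible \<alpha> lam \<kappa> s t.
      (let q = \<alpha> - unit_index s - p; r = lam + \<kappa> + unit_index t - p
       in \<Lambda> / mi_fact q *
          (a3 (\<kappa> + unit_index t) lam p r - a3 lam (\<kappa> + unit_index t) p r) *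
          B_coeff \<gamma> s t r q))"
proof -
  interpret landau \<Lambda> \<gamma> by (rule landau.intro) (use assms in auto)
  let ?K = "2 powr ((\<gamma> + 3 - real (mi_abs \<alpha>)) / 2)"
  let ?q = "\<lambda>s p. \<alpha> - unit_index s - p" and ?r = "\<lambda>t p. lam + \<kappa> + unit_index t - p"
  have *: "1 / mi_fact \<alpha> * (real (\<alpha> $ s) *
     (kern_moment s t (\<alpha> - unit_index s) (\<kappa> + unit_index t) lam - kern_moment s t (\<alpha> - unit_index s) lam (\<kappa> + unit_index t))) =
     ?K * (\<Sum>p\<in>admissible \<alpha> lam \<kappa> s t. \<Lambda> / mi_fact (?q s p) *
          (a3 (\<kappa> + unit_index t) lam p (?r t p) - a3 lam (\<kappa> + unit_index t) p (?r t p)) * B_coeff \<gamma> s t (?r t p) (?q s p))"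
    (is "?L = ?R") for s t
  proof (cases "\<alpha> $ s = 0")
    case True
    \<comment> \<open>Here \<open>\<alpha> - unit_index s\<close> is a truncated difference, but both sides are zero.\<close>
    have "\<not> p + unit_index s \<le> \<alpha>" for p
      using True by (auto simp: less_eq_vec_def intro!: exI[of _ s])
    then have "admissible \<alpha> lam \<kappa> s t = {}" by (simp add: admissible_def)
    with True show ?thesis by simp
  next
    case False
    let ?P = "admissible \<alpha> lam \<kappa> s t" and ?a = "\<alpha> - unit_index s"
    \<comment> \<open>In \<open>a3\<close> the first upper index belongs to the Hermite function of \<open>v\<close>, the second to that of \<open>v - u\<close>.\<close>
    have c: "\<kappa> + unit_index t + lam = lam + \<kappa> + unit_index t" "lam + (\<kappa> + unit_index t) = lam + \<kappa> + unit_index t"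
      by (simp_all add: add_ac)
    have K: "2 powr ((\<gamma> + 2 - real (mi_abs ?a)) / 2) = ?K"
      unfolding mi_abs_minus_unit[OF False] by (simp add: algebra_simps)
    have m: "kern_moment s t ?a b d = mi_fact ?a * (?K *
       (\<Sum>p\<in>?P. \<Lambda> / mi_fact (?q s p) * a3 b d p (?r t p) * B_coeff \<gamma> s t (?r t p) (?q s p)))"
      if "b + d = lam + \<kappa> + unit_index t" for b d
      unfolding kern_moment_eq_sum that K admissible_eq[OF False, symmetric] sum_distrib_left
      by (intro sum.cong refl) (simp only: divide_inverse mult_ac)
    have "?L = ?K * (\<Sum>p\<in>?P. \<Lambda> / mi_fact (?q s p) * a3 (\<kappa> + unit_index t) lam p (?r t p) * B_coeff \<gamma> s t (?r t p) (?q s p))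
        - ?K * (\<Sum>p\<in>?P. \<Lambda> / mi_fact (?q s p) * a3 lam (\<kappa> + unit_index t) p (?r t p) * B_coeff \<gamma> s t (?r t p) (?q s p))"
      unfolding m[OF c(1)] m[OF c(2)] mi_fact_minus_unit[OF False] right_diff_distrib[symmetric]
      using False mi_fact_pos[of ?a] by simp
    also have "\<dots> = ?R"
      by (simp only: right_diff_distrib[symmetric] sum_subtractf[symmetric] left_diff_distrib[symmetric])
    finally show ?thesis .
  qed
  show ?thesis
    unfolding landau_coeff_eq_kern_moment Let_def sum_distrib_left * ..
qed

end
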